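(* Let $X$ be a real convex-transitive Banach space which admits a bicontractive linear projection $P: X\to L$ onto some one-dimensional subspace $L$. Assume there is an $\omega$-LUR point $x\in S_X$. Then $X$ is isometrically a Hilbert space.
   Context: $X$ is convex-transitive if $\overline{\mathrm{conv}}(\{T(y):T\in\mathcal{G}_X\})=B_X$ for every $y\in S_X$, with $\mathcal{G}_X$ the group of surjective linear isometries. $P$ is bicontractive if $\|P\|\le1$ and $\|I-P\|\le1$. $x\in S_X$ is an $\omega$-LUR point if every $(x_n)\subset B_X$ with $\|x+x_n\|\to2$ converges weakly to $x$. *)

theory Defs
  imports "HOL-Analysis.Analysis"
begin

definition isometry_group :: "('a::real_normed_vector \<Rightarrow> 'a) set" where
  "isometry_group = {T. linear T \<and> surj T \<and> (\<forall>x. norm (T x) = norm x)}"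

definition convex_transitive :: "'a::real_normed_vector itself \<Rightarrow> bool" where
  "convex_transitive _ \<longleftrightarrow>
     (\<forall>y::'a. norm y = 1 \<longrightarrow>
        closure (convex hull {T y | T. T \<in> (isometry_group :: ('a \<Rightarrow> 'a) set)}) = cball 0 1)"

definition bicontractive_projection :: "('a::real_normed_vector \<Rightarrow> 'a) \<Rightarrow> bool" where
  "bicontractive_projection P \<longleftrightarrow> linear P \<and> (\<forall>x. P (P x) = P x) \<and>
     (\<forall>x. norm (P x) \<le> norm x) \<and> (\<forall>x. norm (x - P x) \<le> norm x)"

definition weakly_convergent_to :: "(nat \<Rightarrow> 'a::real_normed_vector) \<Rightarrow> 'a \<Rightarrow> bool" where
  "weakly_convergent_to xs x \<longleftrightarrow>
     (\<forall>f :: 'a \<Rightarrow> real. bounded_linear f \<longrightarrow> (\<lambda>n. f (xs n)) \<longlonglongrightarrow> f x)"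

definition omega_LUR_point :: "'a::real_normed_vector \<Rightarrow> bool" where
  "omega_LUR_point x \<longleftrightarrow> norm x = 1 \<and>
     (\<forall>xs. (\<forall>n. norm (xs n) \<le> 1) \<longrightarrow> (\<lambda>n. norm (x + xs n)) \<longlonglongrightarrow> 2 \<longrightarrow>
        weakly_convergent_to xs x)"

definition norm_from_inner_product :: "'a::real_normed_vector itself \<Rightarrow> bool" where
  "norm_from_inner_product _ \<longleftrightarrow>
     (\<exists>ip :: 'a \<Rightarrow> 'a \<Rightarrow> real. (\<forall>y. linear (\<lambda>x. ip x y)) \<and> (\<forall>x y. ip x y = ip y x) \<and>
        (\<forall>x. norm x = sqrt (ip x x)))"

end

theory Submission
  imports Defs
begin

text \<open>Write \<open>P = f \<otimes> e\<close> with \<open>norm e = 1\<close>. Conjugating by isometries \<open>T\<close> with \<open>f (T x)\<close> near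
  \<open>1\<close> moves \<open>e\<close> weakly towards the \<open>\<omega>\<close>-LUR point \<open>x\<close>; by Mazur's theorem and convex transitivity,
  every unit vector \<open>y\<close> is then a limit of convex combinations of vectors \<open>u\<close> admitting a
  contraction \<open>I - h \<otimes> u\<close> with \<open>norm h \<le> 1\<close> and \<open>h y\<close> near \<open>1\<close>. Averaging these contractions shows that
  \<open>y\<close> being Birkhoff orthogonal to \<open>z\<close> implies that \<open>z\<close> is Birkhoff orthogonal to \<open>y\<close>.

  In dimension at least three, symmetry of Birkhoff orthogonality forces strict convexity and
  smoothness, and the map sending a vector to its supporting functional maps lines to lines. In an
  affine chart it is therefore linear, which yields a bilinear form with the same supporting
  hyperplanes as the norm. In dimension two, a form of maximal determinant below the squared norm is
  unique, hence invariant under isometries, hence constant on the unit sphere by convex transitivity.\<close>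

section \<open>Separation by functionals of norm at most one\<close>

text \<open>Both bounds on \<open>P\<close> matter: \<open>f z \<le> norm z\<close> makes
  \<open>e\<close> Birkhoff orthogonal to the kernel of \<open>f\<close>, and contractivity of
  \<open>I - P\<close> makes that kernel orthogonal to \<open>e\<close>. So symmetry is given at one
  vector and for one hyperplane, and has to be spread to all unit vectors. The LUR point yields weak
  convergence only, hence convex combinations of the vectors \<open>u\<close>; as each
  \<open>u\<close> has its own \<open>h\<close>, such an average is useful only after
  \<open>h w\<close> has been replaced by one number. Dimension two is separate because
  non-Euclidean planes with symmetric Birkhoff orthogonality exist (Radon planes), so convex
  transitivity has to be used once more. In higher dimension the norm-one supporting functional is
  not additive in the vector even in a Hilbert space; rescaled to the value 1 at a fixed vector it
  becomes affine, which is the purpose of the chart. The space may have infinite dimension.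
  Compactness is therefore applied only to finitely many real parameters: coordinates in a plane for
  strict convexity, coefficients of forms in the planar case.\<close>

definition sublinear :: "('a::real_vector \<Rightarrow> real) \<Rightarrow> bool" where
  "sublinear p \<longleftrightarrow> (\<forall>z w. p (z + w) \<le> p z + p w) \<and> (\<forall>c z. c > 0 \<longrightarrow> p (c *\<^sub>R z) \<le> c * p z)"

lemma sublinearI:
  assumes "\<And>z w. p (z + w) \<le> p z + p w" "\<And>c z. c > 0 \<Longrightarrow> p (c *\<^sub>R z) \<le> c * p z"
  shows "sublinear p"
  using assms by (auto simp: sublinear_def)

lemma sublinear_add: "sublinear p \<Longrightarrow> p (z + w) \<le> p z + p w"
  by (auto simp: sublinear_def)

text \<open>Scaling back by \<open>1/c\<close> gives the reverse inequality. The definition asks for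
  the one direction that is easy to check for infima.\<close>

lemma sublinear_scale:
  assumes "sublinear p" "c > 0"
  shows "p (c *\<^sub>R z) = c * p z"
proof (rule antisym)
  show "p (c *\<^sub>R z) \<le> c * p z" using assms by (auto simp: sublinear_def)
  have "p ((1/c) *\<^sub>R (c *\<^sub>R z)) \<le> (1/c) * p (c *\<^sub>R z)"
    using assms unfolding sublinear_def by (meson divide_pos_pos zero_less_one)
  then show "c * p z \<le> p (c *\<^sub>R z)" using assms by (simp add: field_simps)
qed

lemma sublinear_zero:
  assumes "sublinear p"
  shows "p 0 = 0"
  using sublinear_scale[OF assms, of 2 0] by simp

lemma sublinear_neg:
  assumes "sublinear p"
  shows "- p (- z) \<le> p z"
  using sublinear_add[OF assms, of z "-z"] sublinear_zero[OF assms] by simp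

text \<open>For fixed \<open>v\<close>, the infimum over \<open>t \<ge> 0\<close> of
  \<open>m (z + t v) - t * m v\<close> is sublinear in \<open>z\<close> and lies below
  \<open>m\<close>, so it equals \<open>m\<close> by minimality. The term with \<open>t = 1\<close>
  then says that \<open>m\<close> is superadditive.\<close>

lemma linear_minimal_sublinear:
  assumes m: "sublinear m" and min: "\<And>q. sublinear q \<Longrightarrow> (\<And>z. q z \<le> m z) \<Longrightarrow> q = m"
  shows "linear m"
proof -
  have super: "m z + m v \<le> m (z + v)" for z v
  proof -
    define S where "S z = (\<lambda>t. m (z + t *\<^sub>R v) - t * m v) ` {0..}" for z
    define q where "q z = Inf (S z)" for z
    have low: "- m (- z) \<le> y" if y: "y \<in> S z" for y z
    proof -
      obtain t where t: "t \<ge> 0" "y = m (z + t *\<^sub>R v) - t * m v"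
        using y by (auto simp: S_def)
      have "t * m v = m (t *\<^sub>R v)"
        using t sublinear_scale[OF m, of t v] sublinear_zero[OF m] by (cases "t = 0") auto
      also have "\<dots> \<le> m (z + t *\<^sub>R v) + m (- z)"
        using sublinear_add[OF m, of "z + t *\<^sub>R v" "-z"] by simp
      finally show ?thesis using t by simp
    qed
    have bdd: "bdd_below (S z)" for z by (rule bdd_belowI[OF low])
    have ne: "S z \<noteq> {}" for z by (auto simp: S_def)
    have upper: "q z \<le> m (z + t *\<^sub>R v) - t * m v" if "t \<ge> 0" for z t
      unfolding q_def by (rule cInf_lower[OF _ bdd]) (use that in \<open>auto simp: S_def\<close>)
    have "sublinear q"
    proof (rule sublinearI)
      fix z w
      have "q (z + w) - y1 \<le> y2" if y: "y1 \<in> S z" "y2 \<in> S w" for y1 y2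
      proof -
        obtain t1 t2 where t: "t1 \<ge> 0" "y1 = m (z + t1 *\<^sub>R v) - t1 * m v"
          "t2 \<ge> 0" "y2 = m (w + t2 *\<^sub>R v) - t2 * m v"
          using y by (auto simp: S_def)
        have "q (z + w) \<le> m (z + w + (t1 + t2) *\<^sub>R v) - (t1 + t2) * m v"
          using t by (intro upper) auto
        also have "z + w + (t1 + t2) *\<^sub>R v = (z + t1 *\<^sub>R v) + (w + t2 *\<^sub>R v)"
          by (simp add: algebra_simps)
        finally show ?thesis
          using sublinear_add[OF m, of "z + t1 *\<^sub>R v" "w + t2 *\<^sub>R v"] t by (simp add: algebra_simps)
      qed
      then have "q (z + w) - y1 \<le> q w" if "y1 \<in> S z" for y1
        unfolding q_def[of w] using that by (intro cInf_greatest ne) auto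
      then have "q (z + w) - q w \<le> q z"
        unfolding q_def[of z] by (intro cInf_greatest ne) (auto simp: algebra_simps)
      then show "q (z + w) \<le> q z + q w" by simp
    next
      fix c :: real and z assume c: "c > 0"
      have "q (c *\<^sub>R z) / c \<le> y" if y: "y \<in> S z" for y
      proof -
        obtain t where t: "t \<ge> 0" "y = m (z + t *\<^sub>R v) - t * m v"
          using y by (auto simp: S_def)
        have "q (c *\<^sub>R z) \<le> m (c *\<^sub>R z + (c * t) *\<^sub>R v) - (c * t) * m v"
          using t c by (intro upper) auto
        also have "c *\<^sub>R z + (c * t) *\<^sub>R v = c *\<^sub>R (z + t *\<^sub>R v)"
          by (simp add: algebra_simps)
        also have "m (c *\<^sub>R (z + t *\<^sub>R v)) - c * t * m v = c * y"
          unfolding sublinear_scale[OF m c] t(2) by (simp add: algebra_simps)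
        finally show ?thesis using c by (simp add: field_simps)
      qed
      then have "q (c *\<^sub>R z) / c \<le> q z"
        unfolding q_def[of z] by (intro cInf_greatest ne) auto
      then show "q (c *\<^sub>R z) \<le> c * q z" using c by (simp add: field_simps)
    qed
    moreover have "q z \<le> m z" for z using upper[of 0 z] by simp
    ultimately have "q = m" by (rule min)
    then show ?thesis using upper[of 1 z] by simp
  qed
  have add: "m (z + w) = m z + m w" for z w
    using super[of z w] sublinear_add[OF m, of z w] by simp
  have neg: "m (- z) = - m z" for z
    using add[of z "-z"] sublinear_zero[OF m] by simp
  show ?thesis
  proof (rule linearI)
    show "m (z + w) = m z + m w" for z w by (rule add)
    fix c :: real and z
    consider "c > 0" | "c = 0" | "c < 0" by linarith
    then show "m (c *\<^sub>R z) = c *\<^sub>R m z"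
    proof cases
      case 3
      then show ?thesis
        using sublinear_scale[OF m, of "-c" z] neg[of "c *\<^sub>R z"] by simp
    qed (use sublinear_scale[OF m] sublinear_zero[OF m] in auto)
  qed
qed

text \<open>Zorn's lemma is applied to the sublinear maps below \<open>p\<close> instead of partial
  extensions. The pointwise infimum bounds a chain; it is finite because \<open>- p (- z)\<close>
  lies below every member.\<close>

lemma hahn_banach_sublinear:
  fixes p :: "'a::real_vector \<Rightarrow> real"
  assumes p: "sublinear p"
  shows "\<exists>f. linear f \<and> (\<forall>z. f z \<le> p z)"
proof -
  define A where "A = {q. sublinear q \<and> (\<forall>z. q z \<le> p z)}"
  define R where "R = (\<lambda>(q1 :: 'a \<Rightarrow> real) q2. \<forall>z. q2 z \<le> q1 z)"
  have po: "partial_order_on A (relation_of R A)"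
    by (rule partial_order_on_relation_ofI) (auto simp: R_def fun_eq_iff intro: order.trans antisym)
  have "\<exists>m\<in>A. \<forall>a\<in>A. R m a \<longrightarrow> a = m"
  proof (rule predicate_Zorn[OF po])
    fix C assume C: "C \<in> Chains (relation_of R A)"
    have CA: "C \<subseteq> A" using C by (auto simp: Chains_def relation_of_def)
    have chain: "R a b \<or> R b a" if "a \<in> C" "b \<in> C" for a b
      using C that by (auto simp: Chains_def relation_of_def)
    show "\<exists>u\<in>A. \<forall>a\<in>C. R a u"
    proof (cases "C = {}")
      case True
      then show ?thesis using p by (auto simp: A_def)
    next
      case False
      define u where "u z = (INF q\<in>C. q z)" for z
      have low: "- p (- z) \<le> q z" if "q \<in> C" for q z
      proof -
        have "sublinear q" "q (- z) \<le> p (- z)" using that CA by (auto simp: A_def)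
        then show ?thesis using sublinear_neg[of q z] by simp
      qed
      have bdd: "bdd_below ((\<lambda>q. q z) ` C)" for z using low by (auto intro!: bdd_belowI)
      have le: "u z \<le> q z" if "q \<in> C" for q z
        unfolding u_def by (rule cINF_lower[OF bdd that])
      have ge: "a \<le> u z" if "\<And>q. q \<in> C \<Longrightarrow> a \<le> q z" for a z
        unfolding u_def using that False by (intro cINF_greatest) auto
      have "sublinear u"
      proof (rule sublinearI)
        fix z w
        \<comment> \<open>Subadditivity of an infimum needs a single \<open>q\<close> for both
          arguments; the chain supplies the smaller of \<open>q1\<close> and
          \<open>q2\<close>.\<close>
        have "u (z + w) - q1 z \<le> q2 w" if q: "q1 \<in> C" "q2 \<in> C" for q1 q2
        proof -
          obtain q where qq: "q \<in> C" "q z \<le> q1 z" "q w \<le> q2 w"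
            using chain[OF q] q by (auto simp: R_def)
          then have "sublinear q" using CA by (auto simp: A_def)
          then have "q (z + w) \<le> q z + q w" by (rule sublinear_add)
          with qq le[OF qq(1), of "z + w"] show ?thesis by simp
        qed
        then have "u (z + w) - q1 z \<le> u w" if "q1 \<in> C" for q1
          using that by (intro ge) auto
        then have "u (z + w) - u w \<le> u z" by (intro ge) (auto simp: algebra_simps)
        then show "u (z + w) \<le> u z + u w" by simp
      next
        fix c :: real and z assume c: "c > 0"
        have "u (c *\<^sub>R z) / c \<le> q z" if "q \<in> C" for q
        proof -
          have "sublinear q" using that CA by (auto simp: A_def)
          then have "q (c *\<^sub>R z) = c * q z" using c by (rule sublinear_scale)
          then show ?thesis using le[OF that, of "c *\<^sub>R z"] c by (simp add: field_simps)
        qed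
        then have "u (c *\<^sub>R z) / c \<le> u z" by (rule ge)
        then show "u (c *\<^sub>R z) \<le> c * u z" using c by (simp add: field_simps)
      qed
      moreover have "u z \<le> p z" for z
      proof -
        obtain q where "q \<in> C" using False by auto
        moreover from this have "q z \<le> p z" using CA by (auto simp: A_def)
        ultimately show ?thesis using le[of q z] by simp
      qed
      ultimately show ?thesis using le by (auto simp: A_def R_def)
    qed
  qed
  then obtain m where m: "m \<in> A" "\<And>a. a \<in> A \<Longrightarrow> R m a \<Longrightarrow> a = m" by blast
  have "linear m"
  proof (rule linear_minimal_sublinear)
    show "sublinear m" using m by (simp add: A_def)
    fix q assume q: "sublinear q" "\<And>z. q z \<le> m z"
    have "q \<in> A" using q m(1) by (auto simp: A_def intro: order.trans)
    then show "q = m" using q by (intro m(2)) (auto simp: R_def)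
  qed
  then show ?thesis using m by (auto simp: A_def)
qed

text \<open>The functional is found below the sublinear map
  \<open>z \<mapsto> inf (norm (z + t c) - t r)\<close>, with the infimum over \<open>t \<ge> 0\<close> and \<open>c \<in> C\<close>.\<close>
lemma separating_functional:
  fixes C :: "'a::real_normed_vector set"
  assumes C: "convex C" and r: "\<And>c. c \<in> C \<Longrightarrow> r \<le> norm c"
  shows "\<exists>f. linear f \<and> (\<forall>z. f z \<le> norm z) \<and> (\<forall>c\<in>C. r \<le> f c)"
proof -
  \<comment> \<open>The cone over \<open>C\<close> with its apex. The apex gives
    \<open>p z \<le> norm z\<close>, also if \<open>C\<close> is empty, and \<open>(1, c)\<close>
    gives \<open>p (- c) \<le> - r\<close>.\<close>
  define W where "W = insert (0, 0) {(t, t *\<^sub>R c) | t c. t > 0 \<and> c \<in> C}"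
  define S where "S z = (\<lambda>(t, w). norm (z + w) - t * r) ` W" for z
  define p where "p z = Inf (S z)" for z
  have Wr: "t * r \<le> norm w" if "(t, w) \<in> W" for t w
    using that r by (auto simp: W_def)
  have Wadd: "(t1 + t2, w1 + w2) \<in> W" if "(t1, w1) \<in> W" "(t2, w2) \<in> W" for t1 t2 w1 w2
  proof -
    have "(t1 + t2, t1 *\<^sub>R c1 + t2 *\<^sub>R c2) \<in> W" if t: "t1 > 0" "t2 > 0" "c1 \<in> C" "c2 \<in> C" for c1 c2
    proof -
      let ?c = "(t1 / (t1 + t2)) *\<^sub>R c1 + (t2 / (t1 + t2)) *\<^sub>R c2"
      have "?c \<in> C"
        using t by (intro convexD[OF C]) (auto simp: add_divide_distrib[symmetric])
      moreover have "t1 *\<^sub>R c1 + t2 *\<^sub>R c2 = (t1 + t2) *\<^sub>R ?c"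
        using t by (simp add: scaleR_add_right)
      ultimately show ?thesis using t by (auto simp: W_def intro!: exI[of _ ?c])
    qed
    then show ?thesis using that by (auto simp: W_def)
  qed
  have Wscale: "(c * t, c *\<^sub>R w) \<in> W" if "(t, w) \<in> W" "c > 0" for c t w
  proof -
    have "(c * t, c *\<^sub>R (t *\<^sub>R d)) \<in> W" if "t > 0" "d \<in> C" for d
    proof -
      have "c * t > 0" using that \<open>c > 0\<close> by simp
      moreover have "c *\<^sub>R (t *\<^sub>R d) = (c * t) *\<^sub>R d" by simp
      ultimately show ?thesis using that unfolding W_def by blast
    qed
    then show ?thesis using that by (auto simp: W_def)
  qed
  have low: "- norm z \<le> y" if y: "y \<in> S z" for y z
  proof -
    obtain t w where tw: "(t, w) \<in> W" "y = norm (z + w) - t * r" using y by (auto simp: S_def)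
    have "norm w \<le> norm (z + w) + norm z" using norm_triangle_ineq4[of "z + w" z] by simp
    then show ?thesis using Wr[OF tw(1)] tw by simp
  qed
  have bdd: "bdd_below (S z)" for z by (rule bdd_belowI[OF low])
  have ne: "S z \<noteq> {}" for z by (auto simp: S_def W_def)
  have upper: "p z \<le> norm (z + w) - t * r" if "(t, w) \<in> W" for z t w
    unfolding p_def by (rule cInf_lower[OF _ bdd]) (use that in \<open>force simp: S_def\<close>)
  have "sublinear p"
  proof (rule sublinearI)
    fix z1 z2
    have "p (z1 + z2) - y1 \<le> y2" if y: "y1 \<in> S z1" "y2 \<in> S z2" for y1 y2
    proof -
      obtain t1 w1 t2 w2 where tw: "(t1, w1) \<in> W" "y1 = norm (z1 + w1) - t1 * r"
          "(t2, w2) \<in> W" "y2 = norm (z2 + w2) - t2 * r"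
        using y by (auto simp: S_def)
      have "p (z1 + z2) \<le> norm (z1 + z2 + (w1 + w2)) - (t1 + t2) * r"
        using tw by (intro upper Wadd)
      also have "z1 + z2 + (w1 + w2) = (z1 + w1) + (z2 + w2)" by simp
      finally show ?thesis
        using norm_triangle_ineq[of "z1 + w1" "z2 + w2"] tw by (simp add: algebra_simps)
    qed
    then have "p (z1 + z2) - y1 \<le> p z2" if "y1 \<in> S z1" for y1
      unfolding p_def[of z2] using that by (intro cInf_greatest ne) auto
    then have "p (z1 + z2) - p z2 \<le> p z1"
      unfolding p_def[of z1] by (intro cInf_greatest ne) (auto simp: algebra_simps)
    then show "p (z1 + z2) \<le> p z1 + p z2" by simp
  next
    fix c :: real and z assume c: "c > 0"
    have "p (c *\<^sub>R z) / c \<le> y" if y: "y \<in> S z" for y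
    proof -
      obtain t w where tw: "(t, w) \<in> W" "y = norm (z + w) - t * r" using y by (auto simp: S_def)
      have "p (c *\<^sub>R z) \<le> norm (c *\<^sub>R z + c *\<^sub>R w) - (c * t) * r"
        using tw c by (intro upper Wscale)
      also have "c *\<^sub>R z + c *\<^sub>R w = c *\<^sub>R (z + w)" by (simp add: algebra_simps)
      also have "norm (c *\<^sub>R (z + w)) - c * t * r = c * y"
        unfolding norm_scaleR tw(2) using c by (simp add: algebra_simps)
      finally show ?thesis using c by (simp add: field_simps)
    qed
    then have "p (c *\<^sub>R z) / c \<le> p z"
      unfolding p_def[of z] by (intro cInf_greatest ne) auto
    then show "p (c *\<^sub>R z) \<le> c * p z" using c by (simp add: field_simps)
  qed
  then obtain f where f: "linear f" "\<And>z. f z \<le> p z" using hahn_banach_sublinear by blast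
  have "f z \<le> norm z" for z
    using f(2)[of z] upper[of 0 0 z] by (simp add: W_def)
  moreover have "r \<le> f c" if "c \<in> C" for c
  proof -
    have "(1, c) \<in> W" unfolding W_def using that by force
    then have "p (- c) \<le> - r" using upper[of 1 c "-c"] by simp
    then show ?thesis using f(2)[of "-c"] linear_neg[OF f(1), of c] by simp
  qed
  ultimately show ?thesis using f by blast
qed

text \<open>The one-sided bound, applied to \<open>z\<close> and \<open>- z\<close>, says that
  \<open>g\<close> has dual norm at most one. At \<open>u = 0\<close> every such functional
  qualifies.\<close>

definition supports :: "('a::real_normed_vector \<Rightarrow> real) \<Rightarrow> 'a \<Rightarrow> bool" where
  "supports g u \<longleftrightarrow> linear g \<and> (\<forall>z. g z \<le> norm z) \<and> g u = norm u"

text \<open>This is Birkhoff orthogonality, which in a general normed space is not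
  symmetric.\<close>

definition orth :: "'a::real_normed_vector \<Rightarrow> 'a \<Rightarrow> bool" where
  "orth u v \<longleftrightarrow> (\<forall>t. norm u \<le> norm (u + t *\<^sub>R v))"

lemma abs_le_norm_functional:
  assumes "linear g" "\<And>z. g z \<le> norm z"
  shows "\<bar>g z\<bar> \<le> norm (z::'a::real_normed_vector)"
  using assms(2)[of z] assms(2)[of "-z"] linear_neg[OF assms(1), of z] by simp

lemma bounded_linear_functional:
  assumes "linear g" "\<And>z. g z \<le> norm z"
  shows "bounded_linear (g :: 'a::real_normed_vector \<Rightarrow> real)"
proof (rule bounded_linear_intro)
  show "norm (g x) \<le> norm x * 1" for x using abs_le_norm_functional[OF assms] by simp
qed (use assms in \<open>auto simp: linear_add linear_scale\<close>)

lemma supportsD: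
  assumes "supports g u"
  shows "linear g" "g z \<le> norm z" "\<bar>g z\<bar> \<le> norm z" "g u = norm u"
  using assms abs_le_norm_functional by (auto simp: supports_def)

lemma orth_supports:
  assumes "supports g u" "g v = 0"
  shows "orth u v"
  unfolding orth_def
proof
  fix t
  have "norm u = g (u + t *\<^sub>R v)"
    using assms(2) by (simp add: supportsD(4)[OF assms(1)] linear_add[OF supportsD(1)[OF assms(1)]]
        linear_scale[OF supportsD(1)[OF assms(1)]])
  then show "norm u \<le> norm (u + t *\<^sub>R v)" using supportsD(2)[OF assms(1)] by simp
qed

text \<open>The line through \<open>u\<close> in direction \<open>v\<close> stays outside the open
  ball of radius \<open>norm u\<close>. A separating functional is bounded below on the whole line,
  so it vanishes at \<open>v\<close>.\<close>

lemma supports_orth_ex: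
  assumes "orth u v"
  shows "\<exists>g. supports g u \<and> g v = 0"
proof -
  define C where "C = range (\<lambda>t. u + t *\<^sub>R v)"
  have "convex C"
  proof -
    have "C = (+) u ` span {v}" unfolding C_def span_singleton image_image ..
    moreover have "convex (span {v})" by (rule subspace_imp_convex[OF subspace_span])
    ultimately show ?thesis by (simp add: convex_translation)
  qed
  moreover have "norm u \<le> norm c" if "c \<in> C" for c using that assms by (auto simp: C_def orth_def)
  ultimately obtain f where f: "linear f" "\<And>z. f z \<le> norm z" "\<And>c. c \<in> C \<Longrightarrow> norm u \<le> f c"
    using separating_functional[of C "norm u"] by blast
  have ge: "norm u \<le> f u + t * f v" for t
  proof -
    have "u + t *\<^sub>R v \<in> C" by (auto simp: C_def)
    from f(3)[OF this] show ?thesis by (simp add: linear_add[OF f(1)] linear_scale[OF f(1)])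
  qed
  have fu: "f u = norm u" using ge[of 0] f(2)[of u] by simp
  have "f v = 0"
    using ge[of 1] ge[of "-1"] fu by simp
  with f(1,2) fu have "supports f u \<and> f v = 0" by (simp add: supports_def)
  then show ?thesis by blast
qed

lemma supports_ex: "\<exists>g. supports g (u::'a::real_normed_vector)"
  using supports_orth_ex[of u 0] by (auto simp: orth_def)

section \<open>Almost norming vectors of bicontractive pairs\<close>

lemma strict_separating_functional:
  fixes C :: "'a::real_normed_vector set"
  assumes C: "convex C" and a: "a \<notin> closure C"
  obtains g r where "linear g" "\<And>z. g z \<le> norm z" "r > 0" "\<And>c. c \<in> C \<Longrightarrow> g c \<le> g a - r"
proof -
  obtain r where r: "r > 0" "\<And>c. c \<in> C \<Longrightarrow> r \<le> norm (a - c)"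
    using a by (auto simp: closure_approachable not_less dist_norm norm_minus_commute)
  have "(\<lambda>c. a - c) ` C = (+) a ` uminus ` C" by (simp add: image_image)
  then have "convex ((\<lambda>c. a - c) ` C)" using convex_translation[OF convex_negations[OF C], of a] by simp
  then obtain g where g: "linear g" "\<forall>z. g z \<le> norm z" "\<forall>c\<in>(\<lambda>c. a - c) ` C. r \<le> g c"
    using separating_functional[of "(\<lambda>c. a - c) ` C" r] r(2) by blast
  have "g c \<le> g a - r" if "c \<in> C" for c
    using g(3) that by (auto simp: linear_diff[OF g(1)])
  then show ?thesis using that[of g r] g(1,2) r(1) by blast
qed

lemma halfspace_closure_convex_hull:
  assumes g: "bounded_linear g" and S: "\<And>v. v \<in> S \<Longrightarrow> g v \<le> (b::real)"
    and v: "v \<in> closure (convex hull S)"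
  shows "g v \<le> b"
proof -
  interpret bounded_linear g by (rule g)
  have "convex {v. g v \<le> b}"
  proof (rule convexI)
    fix x y :: 'a and s t :: real
    assume "x \<in> {v. g v \<le> b}" "y \<in> {v. g v \<le> b}" and st: "0 \<le> s" "0 \<le> t" "s + t = 1"
    then have "s * g x + t * g y \<le> s * b + t * b" by (intro add_mono mult_left_mono) auto
    also have "\<dots> = b" using st by (metis distrib_right mult_1)
    finally show "s *\<^sub>R x + t *\<^sub>R y \<in> {v. g v \<le> b}" by (simp add: add scaleR)
  qed
  moreover have "closed {v. g v \<le> b}"
    by (intro closed_Collect_le continuous_intros continuous_on)
  ultimately have "closure (convex hull S) \<subseteq> {v. g v \<le> b}"
    using S by (intro closure_minimal hull_minimal) auto
  then show ?thesis using v by auto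
qed

lemma isometry_groupD:
  assumes "T \<in> isometry_group"
  shows "linear T" "norm (T z) = norm z"
  using assms by (auto simp: isometry_group_def)

lemma isometry_group_inverse:
  fixes T :: "'a::real_normed_vector \<Rightarrow> 'a"
  assumes T: "T \<in> isometry_group"
  shows "\<exists>S\<in>isometry_group. (\<forall>z. S (T z) = z) \<and> (\<forall>z. T (S z) = z)"
proof -
  have lin: "linear T" and surj: "surj T" and nrm: "\<And>z. norm (T z) = norm z"
    using T by (auto simp: isometry_group_def)
  have inj: "inj T"
  proof (rule injI)
    fix a b assume "T a = T b"
    then have "norm (T (a - b)) = 0" by (simp add: linear_diff[OF lin])
    then show "a = b" by (simp add: nrm)
  qed
  define S where "S = inv T"
  have ST: "S (T z) = z" for z using inj by (simp add: S_def)
  have TS: "T (S z) = z" for z using surj by (simp add: S_def surj_f_inv_f)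
  have "linear S"
  proof (rule linearI)
    show "S (a + b) = S a + S b" for a b
      by (metis ST TS linear_add[OF lin])
    show "S (c *\<^sub>R a) = c *\<^sub>R S a" for a and c :: real
      by (metis ST TS linear_scale[OF lin])
  qed
  moreover have "surj S" using ST by (metis surjI)
  moreover have "norm (S z) = norm z" for z using nrm[of "S z"] by (simp add: TS)
  ultimately have "S \<in> isometry_group" by (simp add: isometry_group_def)
  then show ?thesis using ST TS by blast
qed

text \<open>Models the conjugates of the projection: if \<open>S\<close> is the inverse of the
  isometry \<open>T\<close>, then \<open>S P T\<close> is \<open>h \<otimes> u\<close> with
  \<open>h = f o T\<close> and \<open>u = S e\<close>. The dependence on \<open>y\<close> lies only
  in \<open>h y\<close> being close to 1.\<close>

definition almost_norming :: "'a::real_normed_vector \<Rightarrow> real \<Rightarrow> 'a set" where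
  "almost_norming y \<epsilon> = {u. norm u \<le> 1 \<and> (\<exists>h. linear h \<and> (\<forall>z. h z \<le> norm z) \<and>
     1 - \<epsilon> \<le> h y \<and> (\<forall>w. norm (w - h w *\<^sub>R u) \<le> norm w))}"

text \<open>Conjugation by an isometry with inverse \<open>R\<close>: \<open>w - h (R w) S u\<close>
  is the image under \<open>S\<close> of \<open>R w - h (R w) u\<close>.\<close>

lemma almost_norming_image:
  assumes S: "S \<in> isometry_group" "R \<in> isometry_group" "\<And>z. S (R z) = z"
    and u: "norm u \<le> 1" and h: "linear h" "\<And>z. h z \<le> norm z" "1 - \<epsilon> \<le> h (R y)"
    "\<And>w. norm (w - h w *\<^sub>R u) \<le> norm w"
  shows "S u \<in> almost_norming y \<epsilon>"
proof -
  note lS = isometry_groupD(1)[OF S(1)] and lR = isometry_groupD(1)[OF S(2)]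
  have "norm (w - h (R w) *\<^sub>R S u) \<le> norm w" for w
  proof -
    have "w - h (R w) *\<^sub>R S u = S (R w - h (R w) *\<^sub>R u)"
      by (simp add: linear_diff[OF lS] linear_scale[OF lS] S(3))
    then show ?thesis using h(4)[of "R w"] isometry_groupD(2) S by metis
  qed
  moreover have "linear (\<lambda>z. h (R z))"
    using linear_compose[OF lR h(1)] by (simp add: comp_def)
  moreover have "h (R z) \<le> norm z" for z
    using h(2)[of "R z"] isometry_groupD(2)[OF S(2)] by simp
  ultimately show ?thesis
    using u h(3) isometry_groupD(2)[OF S(1), of u] unfolding almost_norming_def
    by (intro CollectI conjI exI[of _ "\<lambda>z. h (R z)"]) auto
qed

locale bicontractive_lur =
  fixes f :: "'a::real_normed_vector \<Rightarrow> real" and e x :: 'a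
  assumes convex_trans: "convex_transitive TYPE('a)"
    and f: "linear f" "\<And>z. f z \<le> norm z" "f e = 1" and e: "norm e = 1"
    and bicontractive: "\<And>w. norm (w - f w *\<^sub>R e) \<le> norm w"
    and lur: "omega_LUR_point x"
begin

lemma norm_x: "norm x = 1"
  using lur by (simp add: omega_LUR_point_def)

lemma orbit_dense:
  assumes "norm y = 1" "norm z \<le> 1"
  shows "z \<in> closure (convex hull {T y | T. T \<in> (isometry_group :: ('a \<Rightarrow> 'a) set)})"
  using convex_trans assms unfolding convex_transitive_def by auto

lemma orbit_functional_le:
  assumes "norm y = 1" "norm z \<le> 1" "bounded_linear g"
    "\<And>T. T \<in> (isometry_group :: ('a \<Rightarrow> 'a) set) \<Longrightarrow> g (T y) \<le> (b::real)"
  shows "g z \<le> b"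
  by (rule halfspace_closure_convex_hull[OF assms(3) _ orbit_dense[OF assms(1,2)]])
    (use assms(4) in auto)

lemma lur_weak:
  assumes "\<And>n. norm (z n) \<le> 1" "\<And>n. 2 - inverse (real (Suc n)) \<le> norm (x + z n)"
    "linear g" "\<And>w. g w \<le> norm w"
  shows "(\<lambda>n. g (z n)) \<longlonglongrightarrow> g x"
proof -
  have "(\<lambda>n. norm (x + z n)) \<longlonglongrightarrow> 2"
  proof (rule tendsto_sandwich)
    show "(\<lambda>n. 2 - inverse (real (Suc n))) \<longlonglongrightarrow> 2"
      using tendsto_diff[OF tendsto_const LIMSEQ_inverse_real_of_nat, of 2] by simp
    show "(\<lambda>n. 2) \<longlonglongrightarrow> (2::real)" by simp
    show "\<forall>\<^sub>F n in sequentially. norm (x + z n) \<le> 2"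
    proof (rule always_eventually, rule allI)
      fix n show "norm (x + z n) \<le> 2"
        using norm_triangle_ineq[of x "z n"] assms(1)[of n] norm_x by simp
    qed
  qed (use assms(2) in auto)
  then have "weakly_convergent_to z x"
    using lur assms(1) by (auto simp: omega_LUR_point_def)
  then show ?thesis
    using bounded_linear_functional[OF assms(3,4)] by (auto simp: weakly_convergent_to_def)
qed

text \<open>As the orbit of \<open>x\<close> norms \<open>f\<close>, there are isometries
  \<open>T n\<close> with \<open>f (T n x)\<close> tending to 1. Then \<open>f (T n x + e)\<close>
  tends to 2, so \<open>norm (x + S n e)\<close> does too for the inverses \<open>S n\<close>, and
  \<open>S n e\<close> tends weakly to \<open>x\<close>. No functional can then separate
  \<open>x\<close> from the hull.\<close>

lemma lur_almost_norming:
  assumes \<epsilon>: "\<epsilon> > 0"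
  shows "x \<in> closure (convex hull almost_norming x \<epsilon>)"
proof (rule ccontr)
  assume "\<not> ?thesis"
  then obtain g r where g: "linear g" "\<And>z. g z \<le> norm z" "r > 0"
    and gr: "\<And>c. c \<in> convex hull almost_norming x \<epsilon> \<Longrightarrow> g c \<le> g x - r"
    by (rule strict_separating_functional[OF convex_convex_hull]) blast
  have "\<exists>T\<in>isometry_group. 1 - inverse (real (Suc n)) < f (T x)" for n
  proof (rule ccontr)
    assume neg: "\<not> ?thesis"
    have "f e \<le> 1 - inverse (real (Suc n))"
      by (rule orbit_functional_le[OF norm_x _ bounded_linear_functional[OF f(1,2)]])
        (use neg in \<open>auto simp: e not_less\<close>)
    then show False using f(3) by simp
  qed
  then obtain T where T: "T n \<in> isometry_group" "1 - inverse (real (Suc n)) < f (T n x)" for n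
    by metis
  obtain S where S: "S n \<in> isometry_group" "\<And>z. S n (T n z) = z" "\<And>z. T n (S n z) = z" for n
    using isometry_group_inverse[OF T(1)] by metis
  have u1: "norm (S n e) \<le> 1" for n using isometry_groupD(2)[OF S(1)] e by simp
  have "2 - inverse (real (Suc n)) \<le> norm (x + S n e)" for n
  proof -
    have "2 - inverse (real (Suc n)) \<le> f (T n x + e)"
      using T(2)[of n] by (simp add: linear_add[OF f(1)] f(3))
    also have "\<dots> \<le> norm (T n x + e)" by (rule f(2))
    also have "T n x + e = T n (x + S n e)"
      by (simp add: linear_add[OF isometry_groupD(1)[OF T(1)]] S(3))
    finally show ?thesis by (simp add: isometry_groupD(2)[OF T(1)])
  qed
  then have "(\<lambda>n. g (S n e)) \<longlonglongrightarrow> g x" by (intro lur_weak u1 g)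
  moreover have "\<forall>\<^sub>F n in sequentially. inverse (real (Suc n)) < \<epsilon>"
    using order_tendstoD(2)[OF LIMSEQ_inverse_real_of_nat \<epsilon>] .
  then have "\<forall>\<^sub>F n in sequentially. g (S n e) \<le> g x - r"
  proof eventually_elim
    case (elim n)
    have "S n e \<in> almost_norming x \<epsilon>"
      using T(2)[of n] elim by (intro almost_norming_image[OF S(1) T(1) S(2) _ f(1,2) _ bicontractive]) (auto simp: e)
    then show ?case by (intro gr hull_inc)
  qed
  ultimately have "g x \<le> g x - r" by (rule tendsto_upperbound) simp
  then show False using \<open>r > 0\<close> by simp
qed

text \<open>A functional \<open>g\<close> separating \<open>y\<close> from the slice would make \<open>k + c g\<close>, where \<open>k\<close> supports \<open>y\<close> and
  \<open>c\<close> is small, separate \<open>y\<close> from the whole orbit.\<close>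
lemma orbit_slice_dense:
  assumes y: "norm y = 1" and \<delta>: "\<delta> > 0"
  shows "y \<in> closure (convex hull {T x | T. T \<in> isometry_group \<and> 2 - \<delta> \<le> norm (y + T x)})"
    (is "y \<in> closure (convex hull ?O)")
proof (rule ccontr)
  assume "\<not> ?thesis"
  then obtain g r where g: "linear g" "\<And>z. g z \<le> norm z" "r > 0"
    and gr: "\<And>c. c \<in> convex hull ?O \<Longrightarrow> g c \<le> g y - r"
    by (rule strict_separating_functional[OF convex_convex_hull]) blast
  obtain k where k: "supports k y" using supports_ex by blast
  note k1 = supportsD[OF k]
  \<comment> \<open>Chosen so that both cases lose exactly \<open>c * r\<close>: off the slice
    \<open>k\<close> loses \<open>\<delta>\<close>, while \<open>c * g\<close> can gain at most
    \<open>2 * c\<close> over its value at \<open>y\<close>.\<close>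
  define c where "c = \<delta> / (2 + r)"
  have c: "c > 0" "c * (2 + r) = \<delta>" using \<delta> \<open>r > 0\<close> by (auto simp: c_def)
  define F where "F z = k z + c * g z" for z
  have "bounded_linear F"
    unfolding F_def using g k1
    by (intro bounded_linear_add bounded_linear_functional bounded_linear_const_mult) auto
  moreover have "F (T x) \<le> 1 + c * g y - c * r" if T: "T \<in> isometry_group" for T
  proof (cases "2 - \<delta> \<le> norm (y + T x)")
    case True
    then have "g (T x) \<le> g y - r" using T by (intro gr hull_inc) auto
    then have "c * g (T x) \<le> c * (g y - r)" using c by simp
    moreover have "k (T x) \<le> 1" using k1(2)[of "T x"] isometry_groupD(2)[OF T, of x] norm_x by simp
    ultimately show ?thesis by (simp add: F_def algebra_simps)
  next
    case False
    have "1 + k (T x) \<le> norm (y + T x)"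
      using k1(2)[of "y + T x"] k1(4) y by (simp add: linear_add[OF k1(1)])
    then have "k (T x) \<le> 1 - \<delta>" using False by simp
    moreover have "g (T x) \<le> 1" using g(2)[of "T x"] isometry_groupD(2)[OF T, of x] norm_x by simp
    then have "c * g (T x) \<le> c" using c by simp
    moreover have "- 1 \<le> g y" using abs_le_norm_functional[OF g(1,2), of y] y by simp
    then have "c * (- 1) \<le> c * g y" using c by (intro mult_left_mono) auto
    ultimately show ?thesis using c(2) by (simp add: F_def algebra_simps)
  qed
  ultimately have "F y \<le> 1 + c * g y - c * r"
    by (rule orbit_functional_le[OF norm_x, rotated]) (auto simp: y)
  then have "c * r \<le> 0" using k1(4) y by (simp add: F_def)
  then show False using c \<open>r > 0\<close> by (simp add: mult_le_0_iff)
qed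

text \<open>If \<open>norm (y + T x)\<close> is close to 2, then the inverse of \<open>T\<close>
  moves \<open>y\<close> weakly close to \<open>x\<close>, so \<open>h\<close> takes there nearly
  the value \<open>h x\<close>. Halving \<open>\<epsilon>\<close> leaves room for this
  limit.\<close>

lemma almost_norming_transport:
  assumes y: "norm y = 1" and \<epsilon>: "\<epsilon> > 0" and u: "u \<in> almost_norming x (\<epsilon> / 2)"
  shows "\<exists>\<delta>>0. \<forall>T\<in>isometry_group. 2 - \<delta> \<le> norm (y + T x) \<longrightarrow> T u \<in> almost_norming y \<epsilon>"
proof (rule ccontr)
  assume neg: "\<not> ?thesis"
  obtain h where h: "linear h" "\<And>z. h z \<le> norm z" "1 - \<epsilon> / 2 \<le> h x"
      "\<And>w. norm (w - h w *\<^sub>R u) \<le> norm w" and u1: "norm u \<le> 1"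
    using u by (auto simp: almost_norming_def)
  have "\<exists>T\<in>isometry_group. 2 - inverse (real (Suc n)) \<le> norm (y + T x) \<and> T u \<notin> almost_norming y \<epsilon>" for n
    using neg by (meson inverse_positive_iff_positive of_nat_0_less_iff zero_less_Suc)
  then obtain T where T: "T n \<in> isometry_group" "2 - inverse (real (Suc n)) \<le> norm (y + T n x)"
     "T n u \<notin> almost_norming y \<epsilon>" for n by metis
  obtain S where S: "S n \<in> isometry_group" "\<And>z. S n (T n z) = z" "\<And>z. T n (S n z) = z" for n
    using isometry_group_inverse[OF T(1)] by metis
  have "2 - inverse (real (Suc n)) \<le> norm (x + S n y)" for n
  proof -
    have "S n (y + T n x) = x + S n y"
      by (simp add: linear_add[OF isometry_groupD(1)[OF S(1)]] S(2))
    then show ?thesis using T(2)[of n] isometry_groupD(2)[OF S(1), of n "y + T n x"] by simp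
  qed
  then have "(\<lambda>n. h (S n y)) \<longlonglongrightarrow> h x"
    using isometry_groupD(2)[OF S(1)] y by (intro lur_weak h) auto
  moreover have "1 - \<epsilon> < h x" using h(3) \<epsilon> by simp
  ultimately have "\<forall>\<^sub>F n in sequentially. 1 - \<epsilon> < h (S n y)" by (rule order_tendstoD)
  then obtain n where "1 - \<epsilon> < h (S n y)" by (meson eventually_sequentially order_refl)
  then have "T n u \<in> almost_norming y \<epsilon>"
    by (intro almost_norming_image[OF T(1) S(1) S(3) u1 h(1,2) _ h(4)]) auto
  then show False using T(3) by simp
qed

text \<open>A convex combination \<open>a\<close> close to \<open>x\<close> involves finitely many
  \<open>u\<close>, so one \<open>\<delta>\<close> transports them all. Then \<open>T a\<close> is
  close to \<open>T x\<close> for all \<open>T\<close> in the slice, and the points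
  \<open>T x\<close> approximate \<open>y\<close> in the convex sense.\<close>

lemma almost_norming_dense:
  assumes y: "norm (y::'a) = 1" and \<epsilon>: "\<epsilon> > 0"
  shows "y \<in> closure (convex hull almost_norming y \<epsilon>)"
  unfolding closure_approachable
proof (intro allI impI)
  fix d :: real assume d: "d > 0"
  obtain a where a: "a \<in> convex hull almost_norming x (\<epsilon> / 2)" "dist a x < d / 2"
    using lur_almost_norming[of "\<epsilon> / 2"] \<epsilon> d unfolding closure_approachable by (metis half_gt_zero)
  then obtain U where U: "finite U" "U \<subseteq> almost_norming x (\<epsilon> / 2)" "a \<in> convex hull U"
    unfolding convex_hull_explicit by blast
  have "\<exists>\<delta>>0. \<forall>T\<in>isometry_group. 2 - \<delta> \<le> norm (y + T x) \<longrightarrow> T ` U \<subseteq> almost_norming y \<epsilon>"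
    using U(1,2)
  proof (induction U)
    case empty
    show ?case by (auto intro: exI[of _ 1])
  next
    case (insert u U)
    obtain d1 where d1: "d1 > 0"
        "\<And>T. T \<in> isometry_group \<Longrightarrow> 2 - d1 \<le> norm (y + T x) \<Longrightarrow> T u \<in> almost_norming y \<epsilon>"
      using almost_norming_transport[OF y \<epsilon>, of u] insert.prems by blast
    obtain d2 where d2: "d2 > 0"
        "\<And>T. T \<in> isometry_group \<Longrightarrow> 2 - d2 \<le> norm (y + T x) \<Longrightarrow> T ` U \<subseteq> almost_norming y \<epsilon>"
      using insert by blast
    show ?case
    proof (intro exI[of _ "min d1 d2"] conjI ballI impI)
      show "min d1 d2 > 0" using d1 d2 by simp
      fix T assume T: "T \<in> isometry_group" "2 - min d1 d2 \<le> norm (y + T x)"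
      show "T ` insert u U \<subseteq> almost_norming y \<epsilon>"
        using d1(2)[OF T(1)] d2(2)[OF T(1)] T(2) by auto
    qed
  qed
  then obtain \<delta> where \<delta>: "\<delta> > 0"
      "\<And>T. T \<in> isometry_group \<Longrightarrow> 2 - \<delta> \<le> norm (y + T x) \<Longrightarrow> T ` U \<subseteq> almost_norming y \<epsilon>"
    by blast
  let ?O = "{T x | T. T \<in> isometry_group \<and> 2 - \<delta> \<le> norm (y + T x)}"
  let ?A = "convex hull almost_norming y \<epsilon>"
  \<comment> \<open>A Minkowski sum of convex sets: being convex, it contains the hull as soon as it
    contains the single points \<open>T x\<close>.\<close>
  define E where "E = (\<Union>z\<in>?A. \<Union>w\<in>ball 0 (d / 2). {z + w})"
  have "?O \<subseteq> E"
  proof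
    fix z assume "z \<in> ?O"
    then obtain T where T: "T \<in> isometry_group" "2 - \<delta> \<le> norm (y + T x)" "z = T x" by blast
    note lin = isometry_groupD(1)[OF T(1)]
    have "T a \<in> T ` (convex hull U)" using U(3) by simp
    also have "\<dots> = convex hull (T ` U)" by (simp add: convex_hull_linear_image[OF lin])
    also have "\<dots> \<subseteq> ?A" using \<delta>(2)[OF T(1,2)] by (rule hull_mono)
    finally have "T a \<in> ?A" .
    moreover have "norm (T x - T a) < d / 2"
      using a(2) isometry_groupD(2)[OF T(1), of "x - a"]
      by (simp add: linear_diff[OF lin] dist_norm norm_minus_commute)
    then have "T x - T a \<in> ball 0 (d / 2)" by simp
    moreover have "z = T a + (T x - T a)" using T by simp
    ultimately show "z \<in> E" unfolding E_def by blast
  qed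
  moreover have "convex E" unfolding E_def by (intro convex_sums convex_convex_hull convex_ball)
  ultimately have "convex hull ?O \<subseteq> E" by (intro hull_minimal)
  moreover obtain b where "b \<in> convex hull ?O" "dist b y < d / 2"
    using orbit_slice_dense[OF y \<delta>(1)] d unfolding closure_approachable by (meson half_gt_zero)
  ultimately obtain z w where "z \<in> ?A" "w \<in> ball 0 (d / 2)" "b = z + w" unfolding E_def by blast
  then have "dist z y < d"
    using \<open>dist b y < d / 2\<close> norm_triangle_ineq4[of "b - y" w] by (simp add: dist_norm)
  then show "\<exists>z\<in>?A. dist z y < d" using \<open>z \<in> ?A\<close> by blast
qed

end

section \<open>Symmetry of Birkhoff orthogonality\<close>

text \<open>The one-sided directional derivative of the norm. By convexity the quotients increase
  with \<open>s\<close>, so the infimum is the limit at 0.\<close>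

definition right_derivative :: "'a::real_normed_vector \<Rightarrow> 'a \<Rightarrow> real" where
  "right_derivative y z = (INF s\<in>{0<..}. (norm (y + s *\<^sub>R z) - norm y) / s)"

lemma norm_quotient_lower:
  fixes y z :: "'a::real_normed_vector"
  assumes "s > 0"
  shows "- norm z \<le> (norm (y + s *\<^sub>R z) - norm y) / s"
proof -
  have "norm y \<le> norm (y + s *\<^sub>R z) + norm (s *\<^sub>R z)"
    using norm_triangle_ineq4[of "y + s *\<^sub>R z" "s *\<^sub>R z"] by simp
  then show ?thesis using assms by (simp add: field_simps)
qed

lemma right_derivative_le:
  assumes "s > 0"
  shows "right_derivative y z \<le> (norm (y + s *\<^sub>R z) - norm y) / s"
  unfolding right_derivative_def
  by (rule cINF_lower) (use assms norm_quotient_lower in \<open>auto intro!: bdd_belowI2\<close>)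

lemma right_derivative_ge:
  assumes "\<And>s. s > 0 \<Longrightarrow> a \<le> (norm (y + s *\<^sub>R z) - norm y) / s"
  shows "a \<le> right_derivative y z"
  unfolding right_derivative_def by (rule cINF_greatest) (use assms in auto)

lemma norm_quotient_mono:
  fixes y z :: "'a::real_normed_vector"
  assumes "0 < s" "s \<le> t"
  shows "(norm (y + s *\<^sub>R z) - norm y) / s \<le> (norm (y + t *\<^sub>R z) - norm y) / t"
proof -
  define l where "l = s / t"
  have l: "0 < l" "l \<le> 1" "s = l * t" using assms by (auto simp: l_def)
  have "y + s *\<^sub>R z = (1 - l) *\<^sub>R y + l *\<^sub>R (y + t *\<^sub>R z)"
    using l by (simp add: algebra_simps)
  then have "norm (y + s *\<^sub>R z) \<le> norm ((1 - l) *\<^sub>R y) + norm (l *\<^sub>R (y + t *\<^sub>R z))"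
    by (simp only: norm_triangle_ineq)
  also have "\<dots> = (1 - l) * norm y + l * norm (y + t *\<^sub>R z)" using l by simp
  finally have "norm (y + s *\<^sub>R z) - norm y \<le> l * (norm (y + t *\<^sub>R z) - norm y)"
    by (simp add: algebra_simps)
  then have "(norm (y + s *\<^sub>R z) - norm y) / s \<le> l * (norm (y + t *\<^sub>R z) - norm y) / s"
    using assms by (simp add: divide_right_mono)
  also have "\<dots> = (norm (y + t *\<^sub>R z) - norm y) / t" using l assms by simp
  finally show ?thesis .
qed

lemma right_derivative_approx:
  assumes "\<eta> > 0"
  obtains s0 where "s0 > 0"
    "\<And>s. 0 < s \<Longrightarrow> s \<le> s0 \<Longrightarrow> (norm (y + s *\<^sub>R z) - norm y) / s \<le> right_derivative y z + \<eta>"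
proof -
  have "\<exists>s\<in>{0<..}. (norm (y + s *\<^sub>R z) - norm y) / s < right_derivative y z + \<eta>"
    unfolding right_derivative_def
    by (subst cINF_less_iff[symmetric])
      (use assms norm_quotient_lower in \<open>auto intro!: bdd_belowI2\<close>)
  then show ?thesis using that norm_quotient_mono[of _ _ y z] by (smt (verit) greaterThan_iff)
qed

text \<open>The averaging step: it needs one coefficient \<open>t\<close> for all \<open>u\<close>,
  since only then is the condition on \<open>u\<close> closed and convex.\<close>

lemma norm_bound_closure_convex_hull:
  fixes v w :: "'a::real_normed_vector"
  assumes "\<And>u. u \<in> S \<Longrightarrow> norm (w - t *\<^sub>R u) \<le> R" and v: "v \<in> closure (convex hull S)"
  shows "norm (w - t *\<^sub>R v) \<le> R"
proof -
  let ?B = "(\<lambda>u. t *\<^sub>R u) -` cball w R"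
  have "convex ?B" by (intro convex_linear_vimage convex_cball linearI) (auto simp: algebra_simps)
  moreover have "closed ?B" by (intro closed_vimage continuous_intros) auto
  ultimately have "closure (convex hull S) \<subseteq> ?B"
    using assms(1) by (intro closure_minimal hull_minimal) (auto simp: dist_norm)
  then show ?thesis using v by (auto simp: dist_norm)
qed

context bicontractive_lur
begin

text \<open>Functionals that almost norm \<open>y + s z\<close> take values near the right derivative \<open>j\<close> at \<open>z\<close>, even if
  the norm is not smooth at \<open>y\<close>; this is why \<open>y + s z\<close> and not \<open>y\<close> is approximated. As \<open>h w\<close> is
  then almost constant in \<open>u\<close>, the inequality \<open>norm (w - h w u) \<le> norm w\<close> survives convex combinations.\<close>
lemma right_derivative_nearest_approx:
  fixes z :: 'a
  assumes y: "norm (y :: 'a) = 1" and \<eta>: "\<eta> > 0" "\<eta> < 1"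
  defines "j \<equiv> right_derivative y z"
  shows "norm (z - j *\<^sub>R y) \<le> norm (z + c *\<^sub>R y) +
    (3 + \<bar>c\<bar> * (2 * norm z + 1) + 2 * \<bar>j + c\<bar> * norm z) * \<eta>"
proof -
  obtain s0 where s0: "s0 > 0"
    "\<And>s. 0 < s \<Longrightarrow> s \<le> s0 \<Longrightarrow> (norm (y + s *\<^sub>R z) - 1) / s \<le> j + \<eta>"
    using right_derivative_approx[OF \<eta>(1), of y z] unfolding y j_def by blast
  \<comment> \<open>\<open>s0 / 2\<close> allows the quotient at \<open>2 * s\<close> to be used,
    \<open>\<eta>\<close> keeps \<open>v\<close> near \<open>y\<close> and \<open>h y\<close> near
    1, and the last bound gives \<open>s * norm z < 1\<close>, hence
    \<open>0 < N \<le> 2\<close>.\<close>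
  define s where "s = min (s0 / 2) (min \<eta> (1 / (2 * norm z + 2)))"
  have pos: "0 < 1 / (2 * norm z + 2)" by (simp add: add_nonneg_pos)
  have s: "s > 0" "2 * s \<le> s0" "s \<le> \<eta>" "s \<le> 1 / (2 * norm z + 2)"
    using s0(1) \<eta> pos by (auto simp: s_def)
  have "s * norm z \<le> 1 / (2 * norm z + 2) * norm z" using s by (intro mult_right_mono) auto
  also have "\<dots> < 1" by (simp add: pos_divide_less_eq add_nonneg_pos)
  finally have sz: "s * norm z < 1" .
  define N where "N = norm (y + s *\<^sub>R z)"
  have N1: "\<bar>N - 1\<bar> \<le> s * norm z"
    using norm_triangle_ineq3[of "y + s *\<^sub>R z" y] y s by (simp add: N_def)
  have N: "0 < N" "N \<le> 2" using N1 sz by auto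
  define v where "v = (1 / N) *\<^sub>R (y + s *\<^sub>R z)"
  have v: "norm v = 1" "N *\<^sub>R v = y + s *\<^sub>R z" using N by (auto simp: v_def N_def)
  define w where "w = z + c *\<^sub>R y"
  define \<kappa> where "\<kappa> = 3 + \<bar>c\<bar> * (2 * norm z + 1)"
  \<comment> \<open>The tolerance is proportional to \<open>s\<close> because the estimates for
    \<open>h z\<close> are obtained after division by \<open>s\<close>; with
    \<open>N \<le> 2\<close> it costs at most \<open>\<eta>\<close>.\<close>
  have key: "norm (w - (j + c) *\<^sub>R u) \<le> norm w + \<kappa> * \<eta>"
    if u: "u \<in> almost_norming v (s * \<eta> / 2)" for u
  proof -
    obtain h where h: "linear h" "\<And>z. h z \<le> norm z" "1 - s * \<eta> / 2 \<le> h v"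
      "\<And>w. norm (w - h w *\<^sub>R u) \<le> norm w" and u1: "norm u \<le> 1"
      using u by (auto simp: almost_norming_def)
    have lin: "h (a + t *\<^sub>R b) = h a + t * h b" for a b t
      by (simp add: linear_add[OF h(1)] linear_scale[OF h(1)])
    have "N - s * \<eta> \<le> N * (1 - s * \<eta> / 2)"
      using mult_right_mono[OF N(2), of "s * \<eta> / 2"] s(1) \<eta>(1) by (simp add: algebra_simps)
    also have "\<dots> \<le> N * h v" using h(3) N by simp
    also have "\<dots> = h y + s * h z"
      using lin[of y s z] linear_scale[OF h(1), of N v] unfolding v(2) by simp
    finally have a: "N - s * \<eta> \<le> h y + s * h z" .
    have hy: "h y \<le> 1" using h(2)[of y] y by simp
    have j1: "j \<le> (N - 1) / s" using right_derivative_le[OF s(1), of y z] y by (simp add: N_def j_def)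
    then have j1': "s * j \<le> N - 1" using s by (simp add: field_simps)
    have "s * (j - \<eta>) \<le> s * h z" using j1' a hy by (simp add: algebra_simps)
    then have lo: "j - \<eta> \<le> h z" using s(1) by simp
    \<comment> \<open>The upper bound for \<open>h z\<close> comes from going on to
      \<open>y + 2 s z\<close>: there \<open>h\<close> is below the norm, while it nearly attains
      the norm at \<open>y + s z\<close>. The difference of the two values is
      \<open>s * h z\<close>.\<close>
    have "(norm (y + (2 * s) *\<^sub>R z) - 1) / (2 * s) \<le> j + \<eta>" using s by (intro s0(2)) auto
    then have "norm (y + (2 * s) *\<^sub>R z) \<le> 1 + 2 * s * (j + \<eta>)" using s by (simp add: field_simps)
    moreover have "h y + 2 * s * h z \<le> norm (y + (2 * s) *\<^sub>R z)"
      using h(2)[of "y + (2 * s) *\<^sub>R z"] unfolding lin .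
    ultimately have "s * h z \<le> s * (j + 3 * \<eta>)" using a j1' by (simp add: algebra_simps)
    then have hi: "h z \<le> j + 3 * \<eta>" using s(1) by simp
    have "s * h z \<le> s * norm z" using h(2)[of z] s by simp
    moreover have "s * \<eta> \<le> s" using \<eta>(2) s(1) by simp
    moreover have "s * (2 * norm z + 1) = 2 * (s * norm z) + s" by (simp add: algebra_simps)
    ultimately have "1 - h y \<le> s * (2 * norm z + 1)" using a N1 by linarith
    also have "\<dots> \<le> \<eta> * (2 * norm z + 1)" using s(3) by (intro mult_right_mono) auto
    finally have hy2: "\<bar>h y - 1\<bar> \<le> \<eta> * (2 * norm z + 1)" using hy by simp
    have "\<bar>h w - (j + c)\<bar> \<le> \<bar>h z - j\<bar> + \<bar>c * (h y - 1)\<bar>"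
      unfolding w_def lin by (simp add: algebra_simps)
    also have "\<dots> \<le> 3 * \<eta> + \<bar>c\<bar> * (\<eta> * (2 * norm z + 1))"
      unfolding abs_mult using lo hi \<eta> hy2 by (intro add_mono mult_left_mono) auto
    also have "\<dots> = \<kappa> * \<eta>" by (simp add: \<kappa>_def algebra_simps)
    finally have hw: "\<bar>h w - (j + c)\<bar> \<le> \<kappa> * \<eta>" .
    have "w - (j + c) *\<^sub>R u = (w - h w *\<^sub>R u) + (h w - (j + c)) *\<^sub>R u" by (simp add: algebra_simps)
    then have "norm (w - (j + c) *\<^sub>R u) \<le> norm (w - h w *\<^sub>R u) + norm ((h w - (j + c)) *\<^sub>R u)"
      by (simp only: norm_triangle_ineq)
    also have "\<dots> \<le> norm w + \<kappa> * \<eta> * 1"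
      unfolding norm_scaleR real_norm_def using h(4) hw u1 by (intro add_mono mult_mono) auto
    finally show ?thesis by simp
  qed
  have vc: "v \<in> closure (convex hull almost_norming v (s * \<eta> / 2))"
    using s(1) \<eta> by (intro almost_norming_dense[OF v(1)]) simp
  have "norm (w - (j + c) *\<^sub>R v) \<le> norm w + \<kappa> * \<eta>"
    by (rule norm_bound_closure_convex_hull[OF key vc])
  moreover have "norm (v - y) \<le> 2 * norm z * \<eta>"
  proof -
    have "v - y = (1 - N) *\<^sub>R v + s *\<^sub>R z" using v(2) by (simp add: algebra_simps)
    then have "norm (v - y) \<le> \<bar>1 - N\<bar> * norm v + s * norm z"
      using norm_triangle_ineq[of "(1 - N) *\<^sub>R v" "s *\<^sub>R z"] s by simp
    also have "\<dots> \<le> 2 * norm z * s" using v(1) N1 by simp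
    also have "\<dots> \<le> 2 * norm z * \<eta>" using s(3) by (intro mult_left_mono) auto
    finally show ?thesis .
  qed
  moreover have "z - j *\<^sub>R y = (w - (j + c) *\<^sub>R v) + (j + c) *\<^sub>R (v - y)"
    by (simp add: w_def algebra_simps)
  then have "norm (z - j *\<^sub>R y) \<le> norm (w - (j + c) *\<^sub>R v) + \<bar>j + c\<bar> * norm (v - y)"
    using norm_triangle_ineq[of "w - (j + c) *\<^sub>R v" "(j + c) *\<^sub>R (v - y)"] by simp
  ultimately have "norm (z - j *\<^sub>R y) \<le> norm w + \<kappa> * \<eta> + \<bar>j + c\<bar> * (2 * norm z * \<eta>)"
    by (smt (verit) abs_ge_zero mult_left_mono)
  then show ?thesis by (simp add: w_def \<kappa>_def algebra_simps)
qed

text \<open>The limit \<open>\<eta> \<rightarrow> 0\<close>. It says that \<open>z - j y\<close>,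
  with \<open>j\<close> the right derivative, is a point of least norm on the line through
  \<open>z\<close> in direction \<open>y\<close>.\<close>

lemma right_derivative_nearest:
  assumes y: "norm (y :: 'a) = 1"
  shows "norm (z - right_derivative y z *\<^sub>R y) \<le> norm (z + c *\<^sub>R y)"
proof (rule field_le_epsilon)
  fix d :: real assume d: "d > 0"
  let ?j = "right_derivative y z"
  define K where "K = 3 + \<bar>c\<bar> * (2 * norm z + 1) + 2 * \<bar>?j + c\<bar> * norm z"
  have K: "K > 0" unfolding K_def by (intro add_pos_nonneg) auto
  define \<eta> where "\<eta> = min (1 / 2) (d / K)"
  have "\<eta> > 0" "\<eta> < 1" using d K by (auto simp: \<eta>_def)
  then have "norm (z - ?j *\<^sub>R y) \<le> norm (z + c *\<^sub>R y) + K * \<eta>"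
    using right_derivative_nearest_approx[OF y, of \<eta> z c] by (simp add: K_def)
  also have "K * \<eta> \<le> K * (d / K)" using K by (intro mult_left_mono) (auto simp: \<eta>_def)
  also have "\<dots> = d" using K by simp
  finally show "norm (z - ?j *\<^sub>R y) \<le> norm (z + c *\<^sub>R y) + d" by simp
qed

text \<open>Orthogonality makes the right derivatives \<open>?a\<close> and \<open>?b\<close> at
  \<open>z\<close> and \<open>- z\<close> nonnegative. Both \<open>z - ?a y\<close> and
  \<open>z + ?b y\<close> have least norm on their common line, and \<open>z\<close> lies between
  them.\<close>

lemma orth_sym_unit:
  assumes y: "norm (y :: 'a) = 1" and o: "orth y z"
  shows "orth z y"
  unfolding orth_def
proof
  fix c
  let ?a = "right_derivative y z" and ?b = "right_derivative y (- z)"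
  have a: "0 \<le> ?a" by (rule right_derivative_ge) (use o in \<open>auto simp: orth_def\<close>)
  have b: "0 \<le> ?b"
  proof (rule right_derivative_ge)
    fix s :: real assume "s > 0"
    have "norm y \<le> norm (y + (- s) *\<^sub>R z)" using o unfolding orth_def by blast
    then show "0 \<le> (norm (y + s *\<^sub>R - z) - norm y) / s" using \<open>s > 0\<close> by simp
  qed
  have A: "norm (z - ?a *\<^sub>R y) \<le> norm (z + c *\<^sub>R y)" by (rule right_derivative_nearest[OF y])
  have "norm (- z - ?b *\<^sub>R y) \<le> norm (- z + (- c) *\<^sub>R y)" by (rule right_derivative_nearest[OF y])
  then have B: "norm (z + ?b *\<^sub>R y) \<le> norm (z + c *\<^sub>R y)"
    using norm_minus_cancel[of "z + ?b *\<^sub>R y"] norm_minus_cancel[of "z + c *\<^sub>R y"] by simp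
  show "norm z \<le> norm (z + c *\<^sub>R y)"
  proof (cases "?a + ?b = 0")
    case True
    then have "?a = 0" using a b by linarith
    then show ?thesis using A by simp
  next
    case False
    then have p: "?a + ?b > 0" using a b by simp
    have "(?a + ?b) *\<^sub>R z = ?b *\<^sub>R (z - ?a *\<^sub>R y) + ?a *\<^sub>R (z + ?b *\<^sub>R y)"
      by (simp add: algebra_simps)
    then have "(?a + ?b) * norm z \<le> ?b * norm (z - ?a *\<^sub>R y) + ?a * norm (z + ?b *\<^sub>R y)"
      using a b p norm_triangle_ineq[of "?b *\<^sub>R (z - ?a *\<^sub>R y)" "?a *\<^sub>R (z + ?b *\<^sub>R y)"]
      by (metis abs_of_nonneg abs_of_pos norm_scaleR)
    also have "\<dots> \<le> ?b * norm (z + c *\<^sub>R y) + ?a * norm (z + c *\<^sub>R y)"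
      using a b A B by (intro add_mono mult_left_mono)
    finally have "(?a + ?b) * norm z \<le> (?a + ?b) * norm (z + c *\<^sub>R y)" by (simp add: algebra_simps)
    then show ?thesis using p by simp
  qed
qed

lemma orth_sym:
  assumes o: "orth (u :: 'a) z"
  shows "orth z u"
proof (cases "u = 0")
  case True
  then show ?thesis by (simp add: orth_def)
next
  case False
  define y where "y = (1 / norm u) *\<^sub>R u"
  have y: "norm y = 1" "u = norm u *\<^sub>R y" using False by (auto simp: y_def)
  have "orth y z"
    unfolding orth_def
  proof
    fix t
    have "norm u \<le> norm (u + (norm u * t) *\<^sub>R z)" using o by (simp add: orth_def)
    also have "u + (norm u * t) *\<^sub>R z = norm u *\<^sub>R (y + t *\<^sub>R z)"
      using y(2) by (simp add: scaleR_add_right)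
    finally show "norm y \<le> norm (y + t *\<^sub>R z)" using False y(1) by simp
  qed
  then have "orth z y" by (rule orth_sym_unit[OF y(1)])
  then have "norm z \<le> norm (z + (t * norm u) *\<^sub>R y)" for t unfolding orth_def by blast
  then show ?thesis using y(2) unfolding orth_def by (metis scaleR_scaleR)
qed

end

section \<open>Strict convexity and smoothness\<close>

lemma not_in_span_singleton_sym:
  assumes "u \<notin> span {v}" "v \<noteq> (0::'a::real_vector)"
  shows "v \<notin> span {u}"
proof
  assume "v \<in> span {u}"
  then obtain c where "v = c *\<^sub>R u" by (auto simp: span_singleton)
  moreover then have "c \<noteq> 0" using assms by auto
  ultimately have "u = (1 / c) *\<^sub>R v" by simp
  then show False using assms by (metis span_base span_scale singletonI)
qed

locale symmetric_orth =
  fixes \<theta> :: "'a::real_normed_vector itself"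
  assumes orth_sym: "orth (u::'a) v \<Longrightarrow> orth v u"
begin

text \<open>Symmetry replaces an extension argument: \<open>r\<close> is corrected by a multiple of
  \<open>v\<close> so that \<open>v\<close> is orthogonal to \<open>r0\<close>; then
  \<open>r0\<close> is orthogonal to \<open>v\<close>, so some functional supporting
  \<open>r0\<close> vanishes at \<open>v\<close>.\<close>

lemma coordinate_functional:
  fixes r v :: 'a
  assumes "r \<notin> span {v}"
  obtains g K where "linear g" "\<And>z. \<bar>g z\<bar> \<le> K * norm z" "g r = (1::real)" "g v = 0" "K > 0"
proof -
  obtain k where k: "supports k v" using supports_ex by blast
  define r0 where "r0 = r - (k r / norm v) *\<^sub>R v"
  have "orth v r0"
  proof (cases "v = 0")
    case True
    then show ?thesis by (simp add: orth_def)
  next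
    case False
    then have "k r0 = 0"
      by (simp add: r0_def linear_diff[OF supportsD(1)[OF k]] linear_scale[OF supportsD(1)[OF k]]
          supportsD(4)[OF k])
    then show ?thesis by (rule orth_supports[OF k])
  qed
  then obtain g where g: "supports g r0" "g v = 0"
    using supports_orth_ex[OF orth_sym] by blast
  have "r0 \<noteq> 0"
  proof
    assume "r0 = 0"
    then have "r = (k r / norm v) *\<^sub>R v" by (simp add: r0_def)
    then show False using assms by (metis span_base span_scale singletonI)
  qed
  have "g r = norm r0"
    using supportsD(4)[OF g(1)] g(2)
    by (simp add: r0_def linear_diff[OF supportsD(1)[OF g(1)]] linear_scale[OF supportsD(1)[OF g(1)]])
  then show ?thesis
    using \<open>r0 \<noteq> 0\<close> supportsD(3)[OF g(1)] g(2)
    by (intro that[of "\<lambda>z. g z / norm r0" "1 / norm r0"])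
      (auto simp: divide_right_mono linear_iff linear_add[OF supportsD(1)[OF g(1)]]
        linear_scale[OF supportsD(1)[OF g(1)]] add_divide_distrib)
qed

end

text \<open>Dimension at least three is expressed by spans so as to include infinite dimension,
  where \<open>dim\<close> is 0.\<close>

locale symmetric_orth_3 = symmetric_orth \<theta> for \<theta> :: "'a::real_normed_vector itself" +
  assumes not_plane: "\<exists>y. y \<notin> span {a, b :: 'a}"
begin

text \<open>\<open>F\<close> is the set of translations in \<open>ker k\<close> along which the sphere is flat around \<open>m\<close>. It is stable
  under small shifts along every \<open>q\<close> in \<open>ker k\<close> orthogonal to the given point, so its intersection
  with a plane has no extreme point, although it is compact.\<close>
lemma strictly_convex:
  fixes m r :: 'a
  assumes m: "norm m = 1" and mr: "norm (m + r) \<le> 1" "norm (m - r) \<le> 1"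
  shows "r = 0"
proof (rule ccontr)
  assume r: "r \<noteq> 0"
  obtain k where k: "supports k m" using supports_ex by blast
  note k1 = supportsD[OF k]
  note klin = linear_add[OF k1(1)] linear_diff[OF k1(1)] linear_scale[OF k1(1)] linear_neg[OF k1(1)]
  have kr: "k r = 0"
    using k1(2)[of "m + r"] k1(2)[of "m - r"] k1(4) m mr by (simp add: klin)
  define F where "F = {f. k f = 0 \<and> norm (m + f) \<le> 1 \<and> norm (m - f) \<le> 1}"
  have Fr: "r \<in> F" using kr mr by (simp add: F_def)
  have F0: "0 \<in> F" using m by (simp add: F_def linear_0[OF k1(1)])
  have Fneg: "- f \<in> F" if "f \<in> F" for f using that by (simp add: F_def klin)
  \<comment> \<open>\<open>k\<close> also supports \<open>m - f\<close>, and \<open>q + s f\<close>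
    lies in its kernel. Symmetry makes \<open>q + s f\<close> orthogonal to \<open>m - f\<close>,
    and adding \<open>s (m - f)\<close> cannot decrease the norm.\<close>
  have L1: "norm (q + s *\<^sub>R f) \<le> norm (q + s *\<^sub>R m)" if "f \<in> F" "k q = 0" for f q s
  proof -
    have "norm (m - f) = 1"
      using that k1(2)[of "m - f"] k1(4) m by (simp add: F_def klin)
    then have "supports k (m - f)" using k that(1) k1(4) m by (simp add: supports_def F_def klin)
    moreover have "k (q + s *\<^sub>R f) = 0" using that by (simp add: F_def klin)
    ultimately have "orth (m - f) (q + s *\<^sub>R f)" by (rule orth_supports)
    then have "orth (q + s *\<^sub>R f) (m - f)" by (rule orth_sym)
    then have "norm (q + s *\<^sub>R f) \<le> norm (q + s *\<^sub>R f + s *\<^sub>R (m - f))" by (simp add: orth_def)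
    then show ?thesis by (simp add: algebra_simps)
  qed
  \<comment> \<open>\<open>L1\<close> says that the projection onto the kernel of \<open>k\<close>
    along \<open>m - f\<close> is a contraction. Composing \<open>g\<close> with it keeps
    \<open>g\<close> on the kernel and prescribes the value \<open>g f\<close> at
    \<open>m\<close>.\<close>
  have L2: "\<exists>\<kappa>. supports \<kappa> q \<and> \<kappa> m = g f \<and> (\<forall>h. k h = 0 \<longrightarrow> \<kappa> h = g h)"
    if f: "f \<in> F" and q: "k q = 0" and g: "supports g q" for f q g
  proof -
    note g1 = supportsD[OF g]
    note glin = linear_add[OF g1(1)] linear_diff[OF g1(1)] linear_scale[OF g1(1)]
    define \<kappa> where "\<kappa> y = g (y + k y *\<^sub>R (f - m))" for y
    have \<kappa>h: "\<kappa> h = g h" if "k h = 0" for h using that by (simp add: \<kappa>_def)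
    have "\<kappa> y \<le> norm y" for y
    proof -
      have kh: "k (y - k y *\<^sub>R m) = 0" using k1(4) m by (simp add: klin)
      have "\<kappa> y = g ((y - k y *\<^sub>R m) + k y *\<^sub>R f)" by (simp add: \<kappa>_def algebra_simps)
      also have "\<dots> \<le> norm ((y - k y *\<^sub>R m) + k y *\<^sub>R f)" by (rule g1(2))
      also have "\<dots> \<le> norm ((y - k y *\<^sub>R m) + k y *\<^sub>R m)" by (rule L1[OF f kh])
      finally show ?thesis by simp
    qed
    moreover have "linear \<kappa>"
      by (rule linearI) (auto simp: \<kappa>_def glin klin algebra_simps)
    moreover have "\<kappa> q = norm q" using \<kappa>h[OF q] g1(4) by simp
    moreover have "\<kappa> m = g f" using k1(4) m by (simp add: \<kappa>_def)
    ultimately show ?thesis using \<kappa>h by (auto simp: supports_def)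
  qed
  \<comment> \<open>The coefficient of \<open>q\<close> is the zero of the functional from
    \<open>L2\<close> (taken for \<open>- f\<close>) on the line through \<open>m + p\<close>. At
    this zero \<open>q\<close> is orthogonal to the point, so by symmetry the point has least norm
    on the line.\<close>
  have shift: "norm (m + p + (g f / norm q) *\<^sub>R q) \<le> norm (m + p)"
    if f: "f \<in> F" and q: "k q = 0" "q \<noteq> 0" and g: "supports g q" "g p = 0" and p: "k p = 0" for f q g p
  proof -
    define t where "t = g f / norm q"
    obtain \<kappa> where \<kappa>: "supports \<kappa> q" "\<kappa> m = g (- f)" "\<And>h. k h = 0 \<Longrightarrow> \<kappa> h = g h"
      using L2[OF Fneg[OF f] q(1) g(1)] by blast
    note \<kappa>1 = supportsD[OF \<kappa>(1)]
    have "\<kappa> (m + p + t *\<^sub>R q) = - g f + g p + t * norm q"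
      using \<kappa>(2) \<kappa>(3)[OF p] \<kappa>1(4) linear_neg[OF supportsD(1)[OF g(1)], of f]
      by (simp add: linear_add[OF \<kappa>1(1)] linear_scale[OF \<kappa>1(1)])
    also have "\<dots> = 0" using g(2) q(2) by (simp add: t_def)
    finally have "orth q (m + p + t *\<^sub>R q)" by (rule orth_supports[OF \<kappa>(1)])
    then have "orth (m + p + t *\<^sub>R q) q" by (rule orth_sym)
    then have "norm (m + p + t *\<^sub>R q) \<le> norm (m + p + t *\<^sub>R q + (- t) *\<^sub>R q)" unfolding orth_def by blast
    then show ?thesis by (simp add: t_def)
  qed
  have L3: "p + (g f / norm q) *\<^sub>R q \<in> F"
    if f: "f \<in> F" and q: "k q = 0" "q \<noteq> 0" and g: "supports g q" "g p = 0" and p: "p \<in> F" for f q g p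
  proof -
    have kp: "k p = 0" using p by (simp add: F_def)
    have gm: "g (- p) = 0" "k (- p) = 0" using g kp by (simp_all add: linear_neg[OF supportsD(1)[OF g(1)]] klin)
    have "norm (m + p + (g f / norm q) *\<^sub>R q) \<le> 1"
      using shift[OF f q g kp] p by (simp add: F_def)
    moreover have "norm (m + - p + (g (- f) / norm q) *\<^sub>R q) \<le> 1"
      using shift[OF Fneg[OF f] q g(1) gm] p by (simp add: F_def)
    moreover have "k (p + (g f / norm q) *\<^sub>R q) = 0" using kp q by (simp add: klin)
    ultimately show ?thesis
      by (simp add: F_def linear_neg[OF supportsD(1)[OF g(1)]] algebra_simps)
  qed
  obtain y where y: "y \<notin> span {m, r}" using not_plane by blast
  define v where "v = y - k y *\<^sub>R m"
  have kv: "k v = 0" using k1(4) m by (simp add: v_def klin)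
  have v: "v \<notin> span {r}"
  proof
    assume "v \<in> span {r}"
    then have "v \<in> span {m, r}" using span_mono[of "{r}" "{m, r}"] by auto
    then have "v + k y *\<^sub>R m \<in> span {m, r}" by (intro span_add span_scale) (auto intro: span_base)
    then show False using y by (simp add: v_def)
  qed
  have rv: "r \<notin> span {v}" by (rule not_in_span_singleton_sym[OF v r])
  define \<phi> where "\<phi> = (\<lambda>p. fst p *\<^sub>R r + snd p *\<^sub>R v)"
  have k\<phi>: "k (\<phi> p) = 0" for p using kr kv by (simp add: \<phi>_def klin)
  have \<phi>0: "p = (0, 0)" if "\<phi> p = 0" for p
  proof -
    have "snd p = 0"
    proof (rule ccontr)
      assume s: "snd p \<noteq> 0"
      have "snd p *\<^sub>R v = - fst p *\<^sub>R r" using that by (simp add: \<phi>_def add_eq_0_iff)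
      then have "v = (- fst p / snd p) *\<^sub>R r" using s by (metis divideR_right scaleR_scaleR divide_inverse mult.commute)
      then show False using v by (metis span_base span_scale singletonI)
    qed
    then show ?thesis using that r by (cases p) (simp add: \<phi>_def)
  qed
  text \<open>\<open>F\<close> spans the plane of \<open>r\<close> and \<open>v\<close>, so no functional supporting a vector of that plane
    vanishes on \<open>F\<close>.\<close>
  define \<epsilon> where "\<epsilon> = norm r / (4 * norm v + 4)"
  have \<epsilon>: "\<epsilon> > 0" using r by (simp add: \<epsilon>_def add_nonneg_pos)
  have \<epsilon>v: "\<epsilon> * norm v < norm r / 2"
  proof -
    have "0 < 4 * norm v + 4" by (simp add: add_nonneg_pos)
    then have "\<epsilon> * (4 * norm v + 4) = norm r" by (simp add: \<epsilon>_def)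
    then have "4 * \<epsilon> + 4 * (\<epsilon> * norm v) = norm r" by (simp add: algebra_simps)
    then show ?thesis using \<epsilon> norm_ge_zero[of r] by linarith
  qed
  \<comment> \<open>A slight tilt of \<open>r\<close>: for small \<open>\<epsilon>\<close> its
    supporting functional stays positive at \<open>r\<close>, and \<open>L3\<close> at
    \<open>p = 0\<close> puts a positive multiple of \<open>q0\<close> into
    \<open>F\<close>.\<close>
  define q0 where "q0 = r + \<epsilon> *\<^sub>R v"
  obtain g0 where g0: "supports g0 q0" using supports_ex by blast
  have q0: "q0 \<noteq> 0" using \<phi>0[of "(1, \<epsilon>)"] by (auto simp: \<phi>_def q0_def)
  have "g0 r = norm q0 - \<epsilon> * g0 v"
    using supportsD(4)[OF g0]
    by (simp add: q0_def linear_add[OF supportsD(1)[OF g0]] linear_scale[OF supportsD(1)[OF g0]])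
  moreover have "norm r \<le> norm q0 + \<epsilon> * norm v"
    using norm_triangle_ineq4[of q0 "\<epsilon> *\<^sub>R v"] \<epsilon> by (simp add: q0_def)
  moreover have "\<epsilon> * g0 v \<le> \<epsilon> * norm v" using supportsD(2)[OF g0, of v] \<epsilon> by simp
  ultimately have "g0 r > 0" using \<epsilon>v by linarith
  define \<tau> where "\<tau> = g0 r / norm q0"
  have \<tau>: "\<tau> > 0" using \<open>g0 r > 0\<close> q0 by (simp add: \<tau>_def)
  have "k q0 = 0" using kr kv by (simp add: q0_def klin)
  then have Fq0: "\<tau> *\<^sub>R q0 \<in> F"
    using L3[OF Fr _ q0 g0 _ F0] linear_0[OF supportsD(1)[OF g0]] by (simp add: \<tau>_def)
  have nonvanish: "\<exists>f\<in>F. g f \<noteq> 0" if "supports g (\<phi> p)" "\<phi> p \<noteq> 0" for g p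
  proof (rule ccontr)
    assume "\<not> ?thesis"
    then have z: "g r = 0" "g (\<tau> *\<^sub>R q0) = 0" using Fr Fq0 by auto
    note gl = linear_add[OF supportsD(1)[OF that(1)]] linear_scale[OF supportsD(1)[OF that(1)]]
    have "g v = 0" using z \<tau> \<epsilon> by (simp add: q0_def gl)
    then have "g (\<phi> p) = 0" using z by (simp add: \<phi>_def gl)
    then show False using supportsD(4)[OF that(1)] that(2) by simp
  qed
  define C where "C = \<phi> -` F"
  have "compact C"
  proof -
    have "F = {f. k f = 0} \<inter> {f. norm (m + f) \<le> 1} \<inter> {f. norm (m - f) \<le> 1}"
      by (auto simp: F_def)
    moreover have "continuous_on UNIV k"
      using bounded_linear_functional[OF k1(1,2)] by (rule linear_continuous_on)
    ultimately have "closed F"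
      by (auto intro!: closed_Int closed_Collect_le closed_Collect_eq continuous_intros)
    moreover have "continuous_on UNIV \<phi>" unfolding \<phi>_def by (intro continuous_intros)
    ultimately have "closed C" unfolding C_def by (rule closed_vimage)
    moreover have "bounded C"
    proof -
      obtain g1 K1 where g1: "linear g1" "\<And>z. \<bar>g1 z\<bar> \<le> K1 * norm z" "g1 r = 1" "g1 v = 0" "K1 > 0"
        by (rule coordinate_functional[OF rv]) blast
      obtain g2 K2 where g2: "linear g2" "\<And>z. \<bar>g2 z\<bar> \<le> K2 * norm z" "g2 v = 1" "g2 r = 0" "K2 > 0"
        by (rule coordinate_functional[OF v]) blast
      have "C \<subseteq> {- 2 * K1..2 * K1} \<times> {- 2 * K2..2 * K2}"
      proof
        fix p assume "p \<in> C"
        then have "\<phi> p \<in> F" by (simp add: C_def)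
        then have n: "norm (\<phi> p) \<le> 2"
          using norm_triangle_ineq4[of "m + \<phi> p" m] m by (simp add: F_def)
        have "g1 (\<phi> p) = fst p" "g2 (\<phi> p) = snd p"
          using g1(3,4) g2(3,4)
          by (simp_all add: \<phi>_def linear_add[OF g1(1)] linear_scale[OF g1(1)]
              linear_add[OF g2(1)] linear_scale[OF g2(1)])
        then have "\<bar>fst p\<bar> \<le> K1 * norm (\<phi> p)" "\<bar>snd p\<bar> \<le> K2 * norm (\<phi> p)"
          using g1(2)[of "\<phi> p"] g2(2)[of "\<phi> p"] by simp_all
        moreover have "K1 * norm (\<phi> p) \<le> K1 * 2" "K2 * norm (\<phi> p) \<le> K2 * 2"
          using n g1(5) g2(5) by simp_all
        ultimately have "\<bar>fst p\<bar> \<le> 2 * K1" "\<bar>snd p\<bar> \<le> 2 * K2" by linarith+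
        then show "p \<in> {- 2 * K1..2 * K1} \<times> {- 2 * K2..2 * K2}" by (cases p) (auto simp: abs_le_iff)
      qed
      then show ?thesis by (rule bounded_subset[rotated]) (intro bounded_Times bounded_closed_interval)
    qed
    ultimately show ?thesis by (simp add: compact_eq_bounded_closed)
  qed
  moreover have "(0, 0) \<in> C" using F0 by (simp add: C_def \<phi>_def)
  \<comment> \<open>A point of \<open>C\<close> farthest from the origin in Euclidean coordinates
    cannot be the midpoint of a nontrivial segment in \<open>C\<close>.\<close>
  ultimately have "\<exists>p\<in>C. \<forall>p'\<in>C. (fst p')\<^sup>2 + (snd p')\<^sup>2 \<le> (fst p)\<^sup>2 + (snd p)\<^sup>2"
    by (intro continuous_attains_sup) (auto intro!: continuous_intros)
  then obtain p0 where p0: "p0 \<in> C" "\<forall>p'\<in>C. (fst p')\<^sup>2 + (snd p')\<^sup>2 \<le> (fst p0)\<^sup>2 + (snd p0)\<^sup>2" by blast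
  obtain a b where "p0 = (a, b)" by (rule prod.exhaust)
  with p0 have ab: "(a, b) \<in> C"
    "\<And>a' b'. (a', b') \<in> C \<Longrightarrow> a'\<^sup>2 + b'\<^sup>2 \<le> a\<^sup>2 + b\<^sup>2" by force+
  define p where "p = \<phi> (a, b)"
  have pF: "p \<in> F" using ab(1) by (simp add: C_def p_def)
  obtain gp where gp: "supports gp p" using supports_ex by blast
  \<comment> \<open>A direction \<open>q\<close> in the plane with \<open>p\<close> orthogonal to
    \<open>q\<close>. Symmetry turns this into a functional supporting \<open>q\<close> and
    vanishing at \<open>p\<close>, as \<open>L3\<close> requires; \<open>f\<close> and
    \<open>- f\<close> move \<open>p\<close> both ways along \<open>q\<close>.\<close>
  obtain c d where cd: "(c, d) \<noteq> (0, 0)" "gp (\<phi> (c, d)) = 0"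
  proof (cases "gp r = 0")
    case True
    then show ?thesis by (intro that[of 1 0]) (auto simp: \<phi>_def)
  next
    case False
    then show ?thesis
      by (intro that[of "gp v" "- gp r"])
        (auto simp: \<phi>_def linear_diff[OF supportsD(1)[OF gp]] linear_scale[OF supportsD(1)[OF gp]])
  qed
  define q where "q = \<phi> (c, d)"
  have q: "q \<noteq> 0" using \<phi>0[of "(c, d)"] cd(1) by (auto simp: q_def)
  have "orth p q" using gp cd(2) unfolding q_def by (rule orth_supports)
  then obtain g where g: "supports g q" "g p = 0" using supports_orth_ex[OF orth_sym] by blast
  obtain f where f: "f \<in> F" "g f \<noteq> 0" using nonvanish g(1) q unfolding q_def by blast
  define t where "t = g f / norm q"
  have t: "t \<noteq> 0" using f(2) q by (simp add: t_def)
  have lin: "\<phi> (a + s * c, b + s * d) = p + s *\<^sub>R q" for s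
    by (simp add: \<phi>_def p_def q_def algebra_simps)
  have "p + t *\<^sub>R q \<in> F" using L3[OF f(1) _ q g pF] k\<phi> by (simp add: t_def q_def)
  moreover have "p + (- t) *\<^sub>R q \<in> F"
    using L3[OF Fneg[OF f(1)] _ q g pF] k\<phi> linear_neg[OF supportsD(1)[OF g(1)], of f] by (simp add: t_def q_def)
  ultimately have "(a + t * c, b + t * d) \<in> C" "(a + - t * c, b + - t * d) \<in> C"
    unfolding C_def vimage_eq lin by auto
  then have "(a + t * c)\<^sup>2 + (b + t * d)\<^sup>2 \<le> a\<^sup>2 + b\<^sup>2" "(a + - t * c)\<^sup>2 + (b + - t * d)\<^sup>2 \<le> a\<^sup>2 + b\<^sup>2"
    by (auto dest: ab(2))
  then have "t\<^sup>2 * (c\<^sup>2 + d\<^sup>2) \<le> 0" by (simp add: power2_eq_square algebra_simps)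
  moreover have "t\<^sup>2 * (c\<^sup>2 + d\<^sup>2) > 0"
    using t cd(1) by (auto simp: sum_power2_gt_zero_iff)
  ultimately show False by simp
qed

text \<open>Each supporting functional singles out a point of least norm on the line through
  \<open>z\<close> in direction \<open>u\<close>, by symmetry. Two functionals differing at
  \<open>z\<close> give two such points, hence a segment in a sphere, against strict
  convexity.\<close>

lemma smooth:
  assumes g1: "supports g1 (u::'a)" and g2: "supports g2 u" and u: "u \<noteq> 0"
  shows "g1 = g2"
proof (rule ext, rule ccontr)
  fix z assume neq: "g1 z \<noteq> g2 z"
  define p where "p g = z - (g z / norm u) *\<^sub>R u" for g
  have orthp: "orth (p g) u" if g: "supports g u" for g
  proof -
    have "g (p g) = 0"
      using u by (simp add: p_def linear_diff[OF supportsD(1)[OF g]] linear_scale[OF supportsD(1)[OF g]]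
          supportsD(4)[OF g])
    then show ?thesis using orth_sym[OF orth_supports[OF g]] by blast
  qed
  have shift: "norm (p g) \<le> norm (z + c *\<^sub>R u)" if g: "supports g u" for g c
  proof -
    have "norm (p g) \<le> norm (p g + (c + g z / norm u) *\<^sub>R u)"
      using orthp[OF g] unfolding orth_def by blast
    then show ?thesis by (simp add: p_def algebra_simps)
  qed
  define a b where "a = p g1" and "b = p g2"
  have form: "a = z + (- (g1 z / norm u)) *\<^sub>R u" "b = z + (- (g2 z / norm u)) *\<^sub>R u"
    by (simp_all add: a_def b_def p_def)
  have ab: "norm a = norm b"
    using shift[OF g1, of "- (g2 z / norm u)"] shift[OF g2, of "- (g1 z / norm u)"] form
    by (simp add: a_def b_def)
  have "a - b = ((g2 z - g1 z) / norm u) *\<^sub>R u" unfolding form by (simp add: algebra_simps diff_divide_distrib)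
  then have ne: "a \<noteq> b" using neq u by auto
  then have pos: "norm a > 0" using ab by auto
  define m where "m = (1 / (2 * norm a)) *\<^sub>R (a + b)"
  define r where "r = (1 / (2 * norm a)) *\<^sub>R (a - b)"
  have "a + b = 2 *\<^sub>R (z + (- ((g1 z + g2 z) / (2 * norm u))) *\<^sub>R u)"
    unfolding form using u by (simp add: scaleR_2 algebra_simps add_divide_distrib)
  then have "2 * norm a \<le> norm (a + b)"
    using shift[OF g1, of "- ((g1 z + g2 z) / (2 * norm u))"] by (simp add: a_def)
  then have m: "norm m = 1"
    using norm_triangle_ineq[of a b] ab pos by (simp add: m_def)
  have "m + r = (1 / norm a) *\<^sub>R a" "m - r = (1 / norm a) *\<^sub>R b"
    by (simp_all add: m_def r_def scaleR_add_right[symmetric] scaleR_diff_right[symmetric] scaleR_2[symmetric])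
  then have "r = 0" using pos ab by (intro strictly_convex[OF m]) simp_all
  then show False using ne pos by (simp add: r_def)
qed

end

section \<open>Supporting functionals and lines\<close>

text \<open>Comparing \<open>n t\<close> with its integer part gives
  \<open>n * |f t - t * f 1| \<le> f 1\<close> for every \<open>n\<close>, so the difference
  vanishes.\<close>

lemma nonneg_additive_imp_linear:
  fixes f :: "real \<Rightarrow> real"
  assumes add: "\<And>s t. f (s + t) = f s + f t" and nonneg: "\<And>t. t \<ge> 0 \<Longrightarrow> f t \<ge> 0"
  shows "f t = t * f 1"
proof -
  have f0: "f 0 = 0" using add[of 0 0] by simp
  have mult: "f (real n * t) = real n * f t" for n t
    by (induction n) (simp_all add: f0 add algebra_simps)
  have pos: "f t = t * f 1" if t: "t \<ge> 0" for t
  proof (rule ccontr)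
    assume "f t \<noteq> t * f 1"
    then obtain n where n: "2 * f 1 < real n * \<bar>f t - t * f 1\<bar>"
      using reals_Archimedean3[of "\<bar>f t - t * f 1\<bar>"] by auto
    define k where "k = nat \<lfloor>real n * t\<rfloor>"
    have k: "real k \<le> real n * t" "real n * t - real k \<le> 1"
      unfolding k_def using t by (auto simp: of_nat_nat) linarith
    have "f (real n * t) = f (real n * t - real k) + real k * f 1"
      using add[of "real n * t - real k" "real k"] mult[of k 1] by simp
    moreover have "0 \<le> f (real n * t - real k)" using k by (intro nonneg) simp
    moreover have "f 1 = f (real n * t - real k) + f (1 - (real n * t - real k))"
      by (simp add: add[symmetric])
    moreover have "0 \<le> f (1 - (real n * t - real k))" using k by (intro nonneg) simp
    moreover have "real n * t * f 1 - real k * f 1 \<le> f 1"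
      using mult_right_mono[OF k(2) nonneg[of 1]] by (simp add: algebra_simps)
    moreover have "real k * f 1 \<le> real n * t * f 1"
      using k(1) nonneg[of 1] by (intro mult_right_mono) auto
    ultimately have "\<bar>real n * f t - real n * t * f 1\<bar> \<le> f 1"
      unfolding mult by linarith
    moreover have "real n * \<bar>f t - t * f 1\<bar> = \<bar>real n * f t - real n * t * f 1\<bar>"
    proof -
      have "real n * (f t - t * f 1) = real n * f t - real n * t * f 1" by (simp add: algebra_simps)
      then show ?thesis using abs_mult[of "real n" "f t - t * f 1"] by simp
    qed
    ultimately show False using n nonneg[of 1] by simp
  qed
  show ?thesis
  proof (cases "t \<ge> 0")
    case False
    then show ?thesis using add[of t "-t"] f0 pos[of "-t"] by simp
  qed (rule pos)
qed

lemma norm_from_inner_product_scaled: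
  fixes ip :: "'a::real_normed_vector \<Rightarrow> 'a \<Rightarrow> real"
  assumes "\<And>y. linear (ip y)" "\<And>x y. ip x y = ip y x"
    and c: "c > 0" "\<And>x. ip x x = c * (norm x)\<^sup>2"
  shows "norm_from_inner_product TYPE('a)"
  unfolding norm_from_inner_product_def
proof (intro exI[of _ "\<lambda>x y. ip x y / c"] conjI allI)
  show "linear (\<lambda>x. ip x y / c)" for y
    by (rule linearI)
      (simp_all add: assms(2)[of _ y] linear_add[OF assms(1)] linear_scale[OF assms(1)] add_divide_distrib)
  show "ip x y / c = ip y x / c" for x y by (simp add: assms(2)[of x y])
  show "norm x = sqrt (ip x x / c)" for x using c by simp
qed

lemma quadratic_modulus_imp_constant:
  fixes F :: "real \<Rightarrow> real"
  assumes K: "\<And>s t. s \<in> {0..1} \<Longrightarrow> t \<in> {0..1} \<Longrightarrow> F s - F t \<le> K * (t - s)\<^sup>2"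
  shows "F 0 = F 1"
proof -
  have "(F has_field_derivative 0) (at s within {0..1})" if s: "s \<in> {0..1}" for s
    unfolding has_field_derivative_iff
  proof (rule Lim_null_comparison)
    show "\<forall>\<^sub>F t in at s within {0..1}. norm ((F t - F s) / (t - s)) \<le> \<bar>K\<bar> * \<bar>t - s\<bar>"
      unfolding eventually_at_filter
    proof (rule always_eventually, intro allI impI)
      fix t assume t: "t \<noteq> s" "t \<in> {0..1}"
      have "\<bar>F t - F s\<bar> \<le> K * (t - s)\<^sup>2"
        using K[OF s t(2)] K[OF t(2) s] by (simp add: power2_commute)
      also have "\<dots> \<le> \<bar>K\<bar> * (t - s)\<^sup>2" by (intro mult_right_mono) auto
      also have "(t - s)\<^sup>2 = \<bar>t - s\<bar> * \<bar>t - s\<bar>" by (simp add: power2_eq_square)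
      finally show "norm ((F t - F s) / (t - s)) \<le> \<bar>K\<bar> * \<bar>t - s\<bar>"
        using t by (simp add: divide_le_eq mult.assoc)
    qed
    have "((\<lambda>t. \<bar>K\<bar> * \<bar>t - s\<bar>) \<longlongrightarrow> \<bar>K\<bar> * \<bar>s - s\<bar>) (at s within {0..1})"
      by (intro tendsto_intros)
    then show "((\<lambda>t. \<bar>K\<bar> * \<bar>t - s\<bar>) \<longlongrightarrow> 0) (at s within {0..1})" by simp
  qed
  then have "\<exists>c. \<forall>t\<in>{0..1}. F t = c"
    by (intro has_field_derivative_zero_constant) auto
  then show ?thesis by auto
qed

text \<open>Since both have the same supporting hyperplanes, the norm is constant on the level sets of the
  form: along a line avoiding the origin, \<open>R\<close> changes by at most \<open>K (t - s)\<^sup>2\<close>.\<close>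
lemma norm_from_inner_product_if_supporting:
  fixes ip :: "'a::real_normed_vector \<Rightarrow> 'a \<Rightarrow> real"
  assumes lin: "\<And>y. linear (ip y)" and sym: "\<And>x y. ip x y = ip y x"
    and pos: "\<And>y. y \<noteq> 0 \<Longrightarrow> ip y y > 0"
    and supp: "\<And>y z. y \<noteq> 0 \<Longrightarrow> norm y * ip y z \<le> norm z * ip y y"
  shows "norm_from_inner_product TYPE('a)"
proof -
  note l2 = linear_add[OF lin] linear_scale[OF lin] linear_diff[OF lin]
  have l1: "ip (a + b) z = ip a z + ip b z" "ip (c *\<^sub>R a) z = c * ip a z" for a b z c
    unfolding sym[of _ z] by (simp_all add: l2)
  define R where "R y = (norm y)\<^sup>2 / ip y y" for y
  have const: "R y = R z" if yz: "y \<noteq> 0" "z \<noteq> 0" for y z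
  proof (cases "\<exists>c. z = c *\<^sub>R y")
    case True
    then obtain c where "z = c *\<^sub>R y" "c \<noteq> 0" using yz by auto
    then show ?thesis by (simp add: R_def l1 l2 power_mult_distrib) (simp add: power2_eq_square)
  next
    case False
    define v where "v = z - y"
    define Y where "Y t = y + t *\<^sub>R v" for t
    define A where "A = ip y y" define B where "B = ip y v" define C where "C = ip v v"
    have v0: "v \<noteq> 0" using False by (metis v_def eq_iff_diff_eq_0 scaleR_one)
    have C: "C > 0" using pos[OF v0] by (simp add: C_def)
    have ipY: "ip (Y s) (Y t) = A + (s + t) * B + s * t * C" for s t
      unfolding Y_def l1 l2 A_def B_def C_def sym[of v y] by (simp add: algebra_simps)
    define D where "D = A * C - B\<^sup>2"
    have gram: "ip (Y s) (Y s) * ip (Y t) (Y t) - (ip (Y s) (Y t))\<^sup>2 = (t - s)\<^sup>2 * D" for s t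
      unfolding ipY D_def by (simp add: algebra_simps power2_eq_square)
    have Ynz: "Y t \<noteq> 0" for t
    proof
      assume "Y t = 0"
      then have e: "(1 - t) *\<^sub>R y + t *\<^sub>R z = 0" by (simp add: Y_def v_def algebra_simps)
      then have "t \<noteq> 0" using yz by auto
      moreover have "t *\<^sub>R z = (t - 1) *\<^sub>R y" using e by (simp add: algebra_simps add_eq_0_iff)
      ultimately have "z = ((t - 1) / t) *\<^sub>R y"
        by (metis divideR_right scaleR_scaleR divide_inverse mult.commute)
      then show False using False by blast
    qed
    have "C * ip (Y t) (Y t) = D + (B + t * C)\<^sup>2" for t
      unfolding ipY D_def by (simp add: algebra_simps power2_eq_square)
    then have CD: "C * ip (Y t) (Y t) \<ge> D" for t by simp
    have D: "D > 0"
    proof -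
      have "C * ip (Y (- B / C)) (Y (- B / C)) = D"
        unfolding ipY D_def using C by (simp add: field_simps power2_eq_square)
      then show ?thesis using pos[OF Ynz] C by (metis mult_pos_pos)
    qed
    \<comment> \<open>The minimum of the form on the line, attained at \<open>t = - B / C\<close>;
      \<open>D\<close> is the Gram determinant of \<open>y\<close> and \<open>v\<close>.\<close>
    define q0 where "q0 = D / C"
    have q0: "q0 > 0" "\<And>t. q0 \<le> ip (Y t) (Y t)"
      using C D CD by (simp_all add: q0_def divide_le_eq mult.commute)
    define M where "M = (norm y + norm v)\<^sup>2 / q0"
    have M: "M \<ge> 0" using q0 by (simp add: M_def)
    have RM: "R (Y t) \<le> M" "R (Y t) \<ge> 0" if "t \<in> {0..1}" for t
    proof -
      have "norm (Y t) \<le> norm y + norm (t *\<^sub>R v)" unfolding Y_def by (rule norm_triangle_ineq)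
      also have "\<dots> \<le> norm y + norm v" using that by (simp add: mult_left_le_one_le)
      finally have "(norm (Y t))\<^sup>2 \<le> (norm y + norm v)\<^sup>2" by (intro power_mono) auto
      then show "R (Y t) \<le> M" unfolding R_def M_def using q0 by (intro frac_le) auto
      show "R (Y t) \<ge> 0" using pos[OF Ynz[of t]] by (simp add: R_def)
    qed
    \<comment> \<open>The first constant serves \<open>I > 0\<close>, where the supporting
      inequality may be squared. If \<open>I \<le> 0\<close>, then \<open>s\<close> and
      \<open>t\<close> are so far apart that the crude bound \<open>M\<close> suffices.\<close>
    define K where "K = max (M * D / q0\<^sup>2) (M * C / (2 * q0))"
    have "R (Y 0) = R (Y 1)"
    proof (rule quadratic_modulus_imp_constant)
      fix s t :: real assume st: "s \<in> {0..1}" "t \<in> {0..1}"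
      define S where "S = ip (Y s) (Y s)"
      define T where "T = ip (Y t) (Y t)"
      define I where "I = ip (Y s) (Y t)"
      have ST: "S \<ge> q0" "T \<ge> q0" using q0 by (auto simp: S_def T_def)
      then have STp: "S > 0" "T > 0" using q0(1) by auto
      have nR: "(norm (Y s))\<^sup>2 = R (Y s) * S" "(norm (Y t))\<^sup>2 = R (Y t) * T"
        using STp by (simp_all add: R_def S_def T_def)
      have "R (Y s) - R (Y t) \<le> M * D / q0\<^sup>2 * (t - s)\<^sup>2 \<or> R (Y s) - R (Y t) \<le> M * C / (2 * q0) * (t - s)\<^sup>2"
      proof (cases "I > 0")
        case True
        have "(norm (Y s) * I)\<^sup>2 \<le> (norm (Y t) * S)\<^sup>2"
          using supp[OF Ynz, of s "Y t"] True unfolding I_def S_def by (intro power_mono) auto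
        then have "R (Y s) * S * I\<^sup>2 \<le> R (Y t) * T * S\<^sup>2" by (simp add: power_mult_distrib nR)
        then have "S * (R (Y s) * I\<^sup>2) \<le> S * (R (Y t) * T * S)" by (simp add: power2_eq_square algebra_simps)
        then have "R (Y s) * I\<^sup>2 \<le> R (Y t) * T * S" using STp by simp
        moreover have "I\<^sup>2 = S * T - (t - s)\<^sup>2 * D" using gram[of s t] by (simp add: S_def T_def I_def)
        ultimately have "(R (Y s) - R (Y t)) * (S * T) \<le> R (Y s) * ((t - s)\<^sup>2 * D)"
          by (simp add: algebra_simps)
        also have "\<dots> \<le> M * ((t - s)\<^sup>2 * D)" using RM st D by (intro mult_right_mono) auto
        finally have "R (Y s) - R (Y t) \<le> M * ((t - s)\<^sup>2 * D) / (S * T)"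
          using STp by (simp add: pos_le_divide_eq)
        also have "\<dots> \<le> M * ((t - s)\<^sup>2 * D) / (q0 * q0)"
          using ST q0 M D by (intro divide_left_mono mult_mono mult_pos_pos) auto
        also have "\<dots> = M * D / q0\<^sup>2 * (t - s)\<^sup>2"
          by (simp add: power2_eq_square[of q0] mult.commute mult.left_commute)
        finally show ?thesis by blast
      next
        case False
        have "S + T - (t - s)\<^sup>2 * C = 2 * I"
          unfolding S_def T_def I_def ipY by (simp add: algebra_simps power2_eq_square)
        then have "2 * q0 \<le> (t - s)\<^sup>2 * C" using False ST by simp
        then have "1 \<le> C / (2 * q0) * (t - s)\<^sup>2" using q0 by (simp add: field_simps)
        then have "M * 1 \<le> M * (C / (2 * q0) * (t - s)\<^sup>2)" using M by (intro mult_left_mono)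
        moreover have "R (Y s) - R (Y t) \<le> M" using RM[OF st(1)] RM[OF st(2)] by linarith
        ultimately show ?thesis by simp
      qed
      moreover have "M * D / q0\<^sup>2 * (t - s)\<^sup>2 \<le> K * (t - s)\<^sup>2" "M * C / (2 * q0) * (t - s)\<^sup>2 \<le> K * (t - s)\<^sup>2"
        by (intro mult_right_mono; simp add: K_def)+
      ultimately show "R (Y s) - R (Y t) \<le> K * (t - s)\<^sup>2" by linarith
    qed
    then show ?thesis by (simp add: Y_def v_def)
  qed
  have "\<exists>c>0. \<forall>y. ip y y = c * (norm y)\<^sup>2"
  proof (cases "\<exists>y::'a. y \<noteq> 0")
    case True
    then obtain y0 :: 'a where y0: "y0 \<noteq> 0" by blast
    show ?thesis
    proof (intro exI[of _ "1 / R y0"] conjI allI)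
      show "1 / R y0 > 0" using y0 pos[OF y0] by (simp add: R_def)
      fix y
      show "ip y y = 1 / R y0 * (norm y)\<^sup>2"
      proof (cases "y = 0")
        case True
        then show ?thesis by (simp add: linear_0[OF lin])
      next
        case False
        then have "ip y y = 1 / R y * (norm y)\<^sup>2" by (simp add: R_def)
        then show ?thesis using const[OF y0 False] by simp
      qed
    qed
  next
    case False
    have "ip y y = 1 * (norm y)\<^sup>2" for y
    proof -
      have "y = 0" using False by blast
      then show ?thesis by (simp add: linear_0[OF lin])
    qed
    then show ?thesis using zero_less_one by blast
  qed
  then show ?thesis using norm_from_inner_product_scaled[of ip, OF lin sym] by blast
qed

context symmetric_orth_3
begin

text \<open>The duality map. By smoothness the choice is unique at nonzero vectors; at 0 it is
  arbitrary, hence the many conditions \<open>u \<noteq> 0\<close>.\<close>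

definition J :: "'a \<Rightarrow> 'a \<Rightarrow> real" where
  "J u = (SOME g. supports g u)"

lemma J_supports: "supports (J u) u"
  unfolding J_def by (rule someI_ex[OF supports_ex])

lemma J_eq: "supports g u \<Longrightarrow> u \<noteq> 0 \<Longrightarrow> g = J u"
  using smooth J_supports by blast

lemmas J_linear = supportsD(1)[OF J_supports]
lemmas J_le = supportsD(2)[OF J_supports]
lemmas J_self = supportsD(4)[OF J_supports]
lemmas J_simps = linear_add[OF J_linear] linear_diff[OF J_linear] linear_scale[OF J_linear]
  linear_neg[OF J_linear] linear_0[OF J_linear] J_self

lemma J_reciprocal:
  assumes "u \<noteq> 0" "v \<noteq> 0" "J u v = 0"
  shows "J v u = 0"
proof -
  have "orth v u" by (rule orth_sym[OF orth_supports[OF J_supports assms(3)]])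
  then obtain g where "supports g v" "g u = 0" using supports_orth_ex by blast
  then show ?thesis using J_eq assms by auto
qed

lemma J_scaleR:
  assumes "u \<noteq> 0" "t \<noteq> 0"
  shows "J (t *\<^sub>R u) z = sgn t * J u z"
proof -
  have "supports (\<lambda>z. sgn t * J u z) (t *\<^sub>R u)"
    unfolding supports_def
  proof (intro conjI allI)
    show "linear (\<lambda>z. sgn t * J u z)" by (rule linearI) (simp_all add: J_simps algebra_simps)
    show "sgn t * J u z \<le> norm z" for z
    proof -
      have "sgn t * J u z \<le> \<bar>sgn t\<bar> * \<bar>J u z\<bar>" by (metis abs_ge_self abs_mult)
      then show ?thesis using supportsD(3)[OF J_supports, of u z] assms by (simp add: abs_sgn_eq)
    qed
    show "sgn t * J u (t *\<^sub>R u) = norm (t *\<^sub>R u)" by (simp add: J_simps abs_sgn)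
  qed
  then have "(\<lambda>z. sgn t * J u z) = J (t *\<^sub>R u)" using assms by (intro J_eq) auto
  then show ?thesis by metis
qed

text \<open>Shows that \<open>J u\<close> and \<open>J v\<close> are independent. If
  \<open>J u\<close> also vanished at \<open>s\<close>, then by reciprocity \<open>J s\<close> would
  vanish at \<open>u\<close> and \<open>v\<close>, hence at \<open>s\<close>.\<close>

lemma J_dual_vector:
  assumes u: "u \<notin> span {v}" and v: "v \<noteq> 0"
  obtains p where "J u p = 1" "J v p = 0"
proof -
  define s where "s = u - (J v u / norm v) *\<^sub>R v"
  have u0: "u \<noteq> 0" using u span_zero by auto
  have s0: "s \<noteq> 0"
  proof
    assume "s = 0"
    then have "u = (J v u / norm v) *\<^sub>R v" by (simp add: s_def)
    then show False using u by (metis span_base span_scale singletonI)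
  qed
  have vs: "J v s = 0" using v by (simp add: s_def J_simps)
  have "J u s \<noteq> 0"
  proof
    assume "J u s = 0"
    then have "J s u = 0" "J s v = 0" using J_reciprocal u0 s0 v vs by auto
    moreover have "J s s = J s u - (J v u / norm v) * J s v"
      by (subst (2) s_def) (simp add: linear_diff[OF J_linear] linear_scale[OF J_linear])
    ultimately have "J s s = 0" by simp
    then show False using s0 by (simp add: J_self)
  qed
  then show ?thesis using vs by (intro that[of "(1 / J u s) *\<^sub>R s"]) (simp_all add: J_simps)
qed

text \<open>If \<open>J u\<close> and \<open>J v\<close> vanish at \<open>z\<close>, then
  \<open>J z\<close> vanishes at \<open>u\<close> and \<open>v\<close>, hence at their combination,
  and reciprocity leads back. So \<open>J\<close> maps projective lines into projective
  lines.\<close>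

lemma J_combination:
  assumes u: "u \<notin> span {v}" and v: "v \<noteq> 0" and w: "\<alpha> *\<^sub>R u + \<beta> *\<^sub>R v \<noteq> 0" (is "?w \<noteq> 0")
  obtains a b where "\<And>z. J (\<alpha> *\<^sub>R u + \<beta> *\<^sub>R v) z = a * J u z + b * J v z"
proof -
  obtain p where p: "J u p = 1" "J v p = 0" by (rule J_dual_vector[OF u v])
  have u0: "u \<noteq> 0" using u span_zero by auto
  obtain q where q: "J v q = 1" "J u q = 0"
    by (rule J_dual_vector[OF not_in_span_singleton_sym[OF u v] u0])
  have ker: "J ?w z = 0" if "J u z = 0" "J v z = 0" for z
  proof (cases "z = 0")
    case False
    then have "J z u = 0" "J z v = 0" using J_reciprocal u0 v that by auto
    then have "J z ?w = 0" by (simp add: J_simps)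
    then show ?thesis using J_reciprocal[of z ?w] False w by blast
  qed (simp add: J_simps)
  have "J ?w z = J ?w p * J u z + J ?w q * J v z" for z
  proof -
    have "J ?w (z - J u z *\<^sub>R p - J v z *\<^sub>R q) = 0" by (rule ker) (simp_all add: J_simps p q)
    then show ?thesis by (simp add: linear_add[OF J_linear] linear_diff[OF J_linear] linear_scale[OF J_linear] algebra_simps)
  qed
  then show ?thesis by (rule that)
qed

end

section \<open>The inner product in dimension at least three\<close>

locale symmetric_orth_chart = symmetric_orth_3 \<theta>
  for \<theta> :: "'a::real_normed_vector itself" +
  fixes e :: 'a
  assumes e: "norm e = 1"
begin

text \<open>The affine chart: \<open>w\<close> runs through the kernel of \<open>J e\<close>, and
  functionals are normalised to the value 1 at \<open>e\<close>. \<open>L\<close> below is the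
  displacement from the value at \<open>w = 0\<close>.\<close>

definition B :: "'a \<Rightarrow> 'a \<Rightarrow> real" where
  "B w z = J (e + w) z / J (e + w) e"

definition L :: "'a \<Rightarrow> 'a \<Rightarrow> real" where
  "L w z = B w z - J e z"

lemma e_nz: "e \<noteq> 0"
  using e by auto

lemma J_e: "J e e = 1"
  using e by (simp add: J_self)

lemma chart_nz: "J e w = 0 \<Longrightarrow> e + w \<noteq> 0"
  using J_simps(1)[of e e w] J_e linear_0[OF J_linear, of e] by force

text \<open>Symmetry makes \<open>w\<close> orthogonal to \<open>e\<close>, so
  \<open>J (e + w) w \<le> norm w \<le> norm (e + w)\<close>. The value 0 is excluded by
  reciprocity, as \<open>J e (e + w) = 1\<close>.\<close>

lemma J_chart_pos:
  assumes w: "J e w = 0"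
  shows "J (e + w) e > 0"
proof -
  have "orth w e" by (rule orth_sym[OF orth_supports[OF J_supports w]])
  then have "norm w \<le> norm (w + 1 *\<^sub>R e)" unfolding orth_def by blast
  moreover have "J (e + w) (e + w) = J (e + w) e + J (e + w) w" by (rule linear_add[OF J_linear])
  ultimately have "J (e + w) e \<ge> 0"
    using J_le[of "e + w" w] by (simp add: J_self add.commute)
  moreover have "J (e + w) e \<noteq> 0"
  proof
    assume "J (e + w) e = 0"
    then have "J e (e + w) = 0" using J_reciprocal e_nz chart_nz[OF w] by blast
    then show False using w J_e by (simp add: J_simps(1))
  qed
  ultimately show ?thesis by simp
qed

lemma B_e: "J e w = 0 \<Longrightarrow> B w e = 1"
  using J_chart_pos[of w] unfolding B_def by (metis divide_self less_irrefl)

lemma B_0: "B 0 z = J e z"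
  by (simp add: B_def J_e)

lemma L_linear: "linear (L w)"
  by (rule linearI) (simp_all add: L_def B_def J_simps add_divide_distrib algebra_simps)

lemmas L_simps = linear_add[OF L_linear] linear_diff[OF L_linear] linear_scale[OF L_linear] linear_0[OF L_linear]

lemma L_0: "L 0 z = 0"
  by (simp add: L_def B_0)

lemma L_e: "J e w = 0 \<Longrightarrow> L w e = 0"
  by (simp add: L_def B_e J_e)

text \<open>\<open>w1 - w2\<close> is the difference of \<open>e + w1\<close> and
  \<open>e + w2\<close>, so its \<open>J\<close> combines \<open>B w1\<close> and
  \<open>B w2\<close>. It vanishes at \<open>e\<close>, where both are 1, so the coefficients are
  opposite.\<close>

lemma B_diff:
  assumes w: "J e w1 = 0" "J e w2 = 0" "w1 \<noteq> w2"
  obtains c where "c \<noteq> 0" "\<And>z. B w1 z - B w2 z = c * J (w1 - w2) z"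
proof -
  have indep: "e + w1 \<notin> span {e + w2}"
  proof
    assume "e + w1 \<in> span {e + w2}"
    then obtain c where c: "e + w1 = c *\<^sub>R (e + w2)" by (auto simp: span_singleton)
    then have "J e (e + w1) = c * J e (e + w2)" by (simp add: linear_scale[OF J_linear])
    then have "c = 1" using w J_e by (simp add: J_simps(1))
    then show False using c w by simp
  qed
  have nz: "1 *\<^sub>R (e + w1) + (- 1) *\<^sub>R (e + w2) \<noteq> 0" using w by simp
  obtain a b where ab: "\<And>z. J (1 *\<^sub>R (e + w1) + (- 1) *\<^sub>R (e + w2)) z = a * J (e + w1) z + b * J (e + w2) z"
    by (rule J_combination[OF indep chart_nz[OF w(2)] nz]) blast
  define a' b' where "a' = a * J (e + w1) e" and "b' = b * J (e + w2) e"
  have ab': "J (w1 - w2) z = a' * B w1 z + b' * B w2 z" for z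
    using ab[of z] J_chart_pos[OF w(1)] J_chart_pos[OF w(2)] by (simp add: a'_def b'_def B_def)
  have "J e (w1 - w2) = 0" using w by (simp add: J_simps(2))
  then have "J (w1 - w2) e = 0" using J_reciprocal e_nz w(3) by auto
  then have "a' + b' = 0" using ab'[of e] w by (simp add: B_e)
  then have b': "b' = - a'" by simp
  have d: "J (w1 - w2) z = a' * (B w1 z - B w2 z)" for z using ab'[of z] b' by (simp add: algebra_simps)
  have "a' \<noteq> 0" using d[of "w1 - w2"] w(3) by (auto simp: J_self)
  then show ?thesis using d by (intro that[of "1 / a'"]) auto
qed

lemma L_eq_J:
  assumes w: "J e w = 0" "w \<noteq> 0"
  obtains c where "c \<noteq> 0" "\<And>z. L w z = c * J w z"
proof -
  obtain c where "c \<noteq> 0" "\<And>z. B w z - B 0 z = c * J (w - 0) z"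
    by (rule B_diff[OF w(1) _ w(2)]) (auto simp: J_simps)
  then show ?thesis by (intro that[of c]) (auto simp: L_def B_0)
qed

text \<open>The chart maps parallelograms to parallelograms, since each side of the image is a multiple
  of the functional \<open>J\<close> of the side.\<close>
lemma L_add_independent:
  assumes w: "J e w1 = 0" "J e w2 = 0" and ind: "w1 \<notin> span {w2}" and w2: "w2 \<noteq> 0"
  shows "L (w1 + w2) z = L w1 z + L w2 z"
proof -
  have w1: "w1 \<noteq> 0" using ind span_zero by auto
  have w12: "J e (w1 + w2) = 0" using w by (simp add: J_simps(1))
  have J0: "J e 0 = 0" by (simp add: J_simps)
  obtain c1 where c1: "\<And>z. B w1 z - B 0 z = c1 * J w1 z"
    using B_diff[OF w(1) J0 w1] by (metis diff_zero)
  obtain c2 where c2: "\<And>z. B w2 z - B 0 z = c2 * J w2 z"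
    using B_diff[OF w(2) J0 w2] by (metis diff_zero)
  have "w1 + w2 \<noteq> w1" "w1 + w2 \<noteq> w2" using w1 w2 by auto
  then obtain c3 c4 where c3: "\<And>z. B (w1 + w2) z - B w1 z = c3 * J w2 z"
     and c4: "\<And>z. B (w1 + w2) z - B w2 z = c4 * J w1 z"
    using B_diff[OF w12 w(1)] B_diff[OF w12 w(2)] by (metis add_diff_cancel_left' add_diff_cancel_right')
  \<comment> \<open>Evaluating the four sides at a vector that sees only \<open>J w1\<close> equates
    the coefficients of the two sides parallel to it.\<close>
  obtain p where p: "J w1 p = 1" "J w2 p = 0" by (rule J_dual_vector[OF ind w2])
  have "c4 = c1" using c1[of p] c2[of p] c3[of p] c4[of p] p by simp
  then show ?thesis using c4[of z] c1[of z] by (simp add: L_def B_0)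
qed

lemma independent_in_kernel:
  assumes "J e w = 0"
  obtains v where "J e v = 0" "v \<notin> span {w}"
proof -
  obtain y where y: "y \<notin> span {e, w}" using not_plane by blast
  define v where "v = y - J e y *\<^sub>R e"
  have "v \<notin> span {w}"
  proof
    assume "v \<in> span {w}"
    then have "v \<in> span {e, w}" using span_mono[of "{w}" "{e, w}"] by auto
    then have "v + J e y *\<^sub>R e \<in> span {e, w}" by (intro span_add span_scale) (auto intro: span_base)
    then show False using y by (simp add: v_def)
  qed
  moreover have "J e v = 0" by (simp add: v_def J_simps(2,3) J_e)
  ultimately show ?thesis by (rule that[rotated])
qed

text \<open>For dependent vectors a detour through some \<open>v\<close> off their line is taken:
  \<open>(s + 1) w2 + v\<close> is also \<open>s w2 + (w2 + v)\<close>, and both sums are of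
  independent vectors or trivial. This needs the third dimension.\<close>

lemma L_add:
  assumes w: "J e w1 = 0" "J e w2 = 0"
  shows "L (w1 + w2) z = L w1 z + L w2 z"
proof -
  consider "w2 = 0" | "w2 \<noteq> 0" "w1 \<notin> span {w2}" | "w2 \<noteq> 0" "w1 \<in> span {w2}" by blast
  then show ?thesis
  proof cases
    case 3
    then obtain s where s: "w1 = s *\<^sub>R w2" by (auto simp: span_singleton)
    obtain v where v: "J e v = 0" "v \<notin> span {w2}" by (rule independent_in_kernel[OF w(2)])
    have step: "L (c *\<^sub>R w2 + u) z = L (c *\<^sub>R w2) z + L u z" if u: "J e u = 0" "u \<notin> span {w2}" for c u
    proof (cases "c = 0")
      case False
      have "u \<notin> span {c *\<^sub>R w2}"
        using u(2) span_mono[of "{c *\<^sub>R w2}" "span {w2}"] span_base[of w2 "{w2}"] span_scale[of w2 "{w2}" c]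
        by (auto simp: span_span)
      then have "L (u + c *\<^sub>R w2) z = L u z + L (c *\<^sub>R w2) z"
        using u w 3 False by (intro L_add_independent) (auto simp: J_simps(3))
      then show ?thesis by (simp add: add.commute)
    qed (simp add: L_0)
    have wv: "w2 + v \<notin> span {w2}"
      using v(2) span_add_eq[of w2 "{w2}" v] span_base[of w2 "{w2}"] by auto
    have "L ((s + 1) *\<^sub>R w2 + v) z = L (w1 + w2) z + L v z"
      using step[OF v, of "s + 1"] by (simp add: s scaleR_add_left)
    moreover have "L (s *\<^sub>R w2 + (w2 + v)) z = L w1 z + L (w2 + v) z"
      using step[of "w2 + v" s] w v wv by (simp add: s J_simps(1))
    moreover have "L (w2 + v) z = L w2 z + L v z" using step[OF v, of 1] by simp
    moreover have "(s + 1) *\<^sub>R w2 + v = s *\<^sub>R w2 + (w2 + v)" by (simp add: algebra_simps)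
    ultimately show ?thesis by simp
  qed (use w L_add_independent in \<open>auto simp: L_0\<close>)
qed

lemma L_pos:
  assumes w: "J e w = 0" "w \<noteq> 0"
  shows "L w w > 0"
proof -
  have "orth e w" using w by (intro orth_supports[OF J_supports])
  then have "norm e \<le> norm (e + 1 *\<^sub>R w)" unfolding orth_def by blast
  then have "1 \<le> J (e + w) (e + w)" using e by (simp add: J_self)
  moreover have "J (e + w) e \<le> 1" using J_le[of "e + w" e] e by simp
  ultimately have "J (e + w) w \<ge> 0" using J_simps(1)[of "e + w" e w] by simp
  then have "L w w \<ge> 0" using w J_chart_pos[OF w(1)] by (simp add: L_def B_def)
  moreover have "L w w \<noteq> 0"
  proof -
    obtain c where "c \<noteq> 0" "\<And>z. L w z = c * J w z" by (rule L_eq_J[OF w]) blast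
    then show ?thesis using w by (simp add: J_self)
  qed
  ultimately show ?thesis by simp
qed

text \<open>Additivity and positivity give homogeneity at the argument \<open>w\<close>. As
  \<open>L (t w)\<close> and \<open>L w\<close> are both multiples of \<open>J w\<close>, this one
  argument decides all others.\<close>

lemma L_scale:
  assumes w: "J e w = 0"
  shows "L (t *\<^sub>R w) z = t * L w z"
proof (cases "w = 0 \<or> t = 0")
  case True
  then show ?thesis by (auto simp: L_0)
next
  case False
  have H: "J e (s *\<^sub>R w) = 0" for s using w by (simp add: J_simps(3))
  have "L (t *\<^sub>R w) w = t * L (1 *\<^sub>R w) w"
  proof (rule nonneg_additive_imp_linear)
    show "L ((s + t) *\<^sub>R w) w = L (s *\<^sub>R w) w + L (t *\<^sub>R w) w" for s t
      by (simp add: scaleR_add_left L_add H)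
    fix s :: real assume s: "s \<ge> 0"
    show "L (s *\<^sub>R w) w \<ge> 0"
    proof (cases "s = 0")
      case False
      then have "s * L (s *\<^sub>R w) w > 0"
        using L_pos[OF H, of s] \<open>\<not> (w = 0 \<or> t = 0)\<close> by (simp add: L_simps(3))
      then show ?thesis using s by (simp add: zero_less_mult_iff)
    qed (simp add: L_0)
  qed
  then have tw: "L (t *\<^sub>R w) w = t * L w w" by simp
  obtain c where c: "c \<noteq> 0" "\<And>z. L w z = c * J w z" using L_eq_J[OF w] False by blast
  obtain d where d: "\<And>z. L (t *\<^sub>R w) z = d * J (t *\<^sub>R w) z" using L_eq_J[OF H, of t] False by auto
  then have dz: "L (t *\<^sub>R w) z = d * sgn t * J w z" for z using J_scaleR False by simp
  have "J w w \<noteq> 0" using False by (simp add: J_self)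
  then have "d * sgn t = t * c" using tw dz[of w] c(2)[of w] by simp
  then show ?thesis using dz c(2) by simp
qed

text \<open>Splitting \<open>w'\<close> into a multiple of \<open>w\<close> and some
  \<open>s\<close> with \<open>L w s = 0\<close> reduces the claim to \<open>L s w = 0\<close>,
  which is reciprocity.\<close>

lemma L_sym:
  assumes w: "J e w = 0" and w': "J e w' = 0"
  shows "L w w' = L w' w"
proof (cases "w = 0")
  case True
  then show ?thesis by (simp add: L_0 L_simps)
next
  case False
  define \<mu> where "\<mu> = L w w' / L w w"
  define s where "s = w' + (- \<mu>) *\<^sub>R w"
  have pos: "L w w > 0" by (rule L_pos[OF w False])
  have s: "J e s = 0" "L w s = 0"
    using w w' pos by (simp_all add: s_def \<mu>_def J_simps L_simps)
  have "L s w = 0"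
  proof (cases "s = 0")
    case sn: False
    obtain c where c: "c \<noteq> 0" "\<And>z. L w z = c * J w z" by (rule L_eq_J[OF w False]) blast
    obtain d where d: "\<And>z. L s z = d * J s z" using L_eq_J[OF s(1) sn] by blast
    have "J w s = 0" using c s(2) by simp
    then show ?thesis using d J_reciprocal[OF False sn] by simp
  qed (simp add: L_0)
  moreover have "J e ((- \<mu>) *\<^sub>R w) = 0" using w by (simp only: J_simps(3)) simp
  then have "L s w = L w' w + L ((- \<mu>) *\<^sub>R w) w" unfolding s_def by (rule L_add[OF w'])
  then have "L s w = L w' w + (- \<mu>) * L w w" unfolding L_scale[OF w] .
  ultimately show ?thesis using pos by (simp add: \<mu>_def)
qed

definition proj :: "'a \<Rightarrow> 'a" where
  "proj y = y - J e y *\<^sub>R e"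

text \<open>The chart made homogeneous: for \<open>y = a (e + w)\<close> this is
  \<open>a * B w z\<close>. Vectors in the kernel of \<open>J e\<close> are the points at infinity,
  where it is \<open>L y z\<close>.\<close>

definition ip :: "'a \<Rightarrow> 'a \<Rightarrow> real" where
  "ip y z = J e y * J e z + L (proj y) z"

lemma J_proj: "J e (proj y) = 0"
  by (simp add: proj_def J_simps(2,3) J_e)

lemma L_proj:
  assumes "J e w = 0"
  shows "L w (proj z) = L w z"
  using L_e[OF assms] by (simp add: proj_def L_simps)

lemma ip_sym: "ip y z = ip z y"
  using L_sym[OF J_proj J_proj, of y z] by (simp add: ip_def L_proj[OF J_proj])

lemma ip_linear: "linear (ip y)"
  by (rule linearI) (simp_all add: ip_def J_simps(1,3) L_simps(1,3) algebra_simps)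

lemma ip_pos:
  assumes "y \<noteq> 0"
  shows "ip y y > 0"
proof (cases "proj y = 0")
  case True
  then have "J e y \<noteq> 0" using assms by (auto simp: proj_def)
  then show ?thesis using True by (simp add: ip_def L_0 zero_less_mult_iff) (auto simp: linorder_neq_iff)
next
  case False
  then have "L (proj y) y > 0" using L_pos[OF J_proj False] L_proj[OF J_proj, of y y] by simp
  then show ?thesis by (simp add: ip_def add_nonneg_pos)
qed

lemma ip_proportional_J:
  assumes y: "y \<noteq> 0"
  shows "\<exists>\<rho>. \<forall>z. ip y z = \<rho> * J y z"
proof (cases "J e y = 0")
  case True
  then have "proj y = y" by (simp add: proj_def)
  then have "ip y z = L y z" for z using True by (simp add: ip_def)
  then show ?thesis using L_eq_J[OF True y] by metis
next
  case False
  define a where "a = J e y"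
  define w where "w = (1 / a) *\<^sub>R proj y"
  have a: "a \<noteq> 0" using False by (simp add: a_def)
  have w: "J e w = 0" using J_proj by (simp add: w_def J_simps(3))
  have y_eq: "y = a *\<^sub>R (e + w)" using a by (simp add: w_def a_def proj_def algebra_simps)
  have "L (proj y) z = a * L w z" for z
    using L_scale[OF w, of a z] a by (simp add: w_def)
  then have "ip y z = a * B w z" for z by (simp add: ip_def a_def[symmetric] L_def algebra_simps)
  moreover have "J y z = sgn a * J (e + w) z" for z
    unfolding y_eq by (rule J_scaleR[OF chart_nz[OF w] a])
  ultimately have "ip y z = (a * sgn a / J (e + w) e) * J y z" for z
    using a by (simp add: B_def sgn_if)
  then show ?thesis by blast
qed

lemma ip_supporting:
  assumes y: "y \<noteq> 0"
  shows "norm y * ip y z \<le> norm z * ip y y"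
proof -
  obtain \<rho> where \<rho>: "\<And>z. ip y z = \<rho> * J y z" using ip_proportional_J[OF y] by blast
  have yy: "ip y y = \<rho> * norm y" using \<rho>[of y] by (simp add: J_self)
  then have "\<rho> > 0" using ip_pos[OF y] y by (simp add: zero_less_mult_iff)
  then have "\<rho> * norm y * J y z \<le> \<rho> * norm y * norm z"
    using J_le[of y z] by (intro mult_left_mono) auto
  then show ?thesis using yy \<rho>[of z] by (simp add: algebra_simps)
qed

lemma norm_from_inner_product: "norm_from_inner_product TYPE('a)"
  by (rule norm_from_inner_product_if_supporting[OF ip_linear ip_sym ip_pos ip_supporting])

end

section \<open>Dimension at most two\<close>

lemma bounded_linear_of_bound:
  assumes "linear g" "\<And>z. \<bar>g z\<bar> \<le> K * norm z"
  shows "bounded_linear (g :: 'a::real_normed_vector \<Rightarrow> real)"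
  by (rule bounded_linear_intro[of _ K])
    (use assms in \<open>auto simp: linear_add linear_scale mult.commute\<close>)

context symmetric_orth
begin

lemma one_dimensional:
  assumes "\<And>y. y \<in> span {u :: 'a}"
  shows "norm_from_inner_product TYPE('a)"
proof -
  obtain k where k: "supports k u" using supports_ex by blast
  note klin = linear_add[OF supportsD(1)[OF k]] linear_scale[OF supportsD(1)[OF k]]
  have sq: "k x * k x = 1 * (norm x)\<^sup>2" for x
  proof -
    obtain c where "x = c *\<^sub>R u" using assms[of x] by (auto simp: span_singleton)
    then show ?thesis by (simp add: klin supportsD(4)[OF k] power2_eq_square)
  qed
  show ?thesis
    by (rule norm_from_inner_product_scaled[of "\<lambda>x y. k x * k y" 1])
      (auto intro!: linearI simp: klin sq algebra_simps)
qed

lemma two_dimensional: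
  assumes ct: "convex_transitive TYPE('a)"
    and uv: "u \<notin> span {v :: 'a}" "v \<notin> span {u}" and plane: "\<And>y. y \<in> span {u, v}"
  shows "norm_from_inner_product TYPE('a)"
proof -
  obtain g1 K1 where g1: "linear g1" "\<And>z. \<bar>g1 z\<bar> \<le> K1 * norm z" "g1 u = 1" "g1 v = 0" "K1 > 0"
    by (rule coordinate_functional[OF uv(1)]) blast
  obtain g2 K2 where g2: "linear g2" "\<And>z. \<bar>g2 z\<bar> \<le> K2 * norm z" "g2 v = 1" "g2 u = 0" "K2 > 0"
    by (rule coordinate_functional[OF uv(2)]) blast
  note l1 = linear_add[OF g1(1)] linear_diff[OF g1(1)] linear_scale[OF g1(1)]
  note l2 = linear_add[OF g2(1)] linear_diff[OF g2(1)] linear_scale[OF g2(1)]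
  have coord: "y = g1 y *\<^sub>R u + g2 y *\<^sub>R v" for y
  proof -
    obtain a where "y - a *\<^sub>R u \<in> span {v}" using plane[of y] unfolding span_breakdown_eq[of y u "{v}"] by blast
    then obtain b where "y - a *\<^sub>R u = b *\<^sub>R v" by (auto simp: span_singleton)
    then have y: "y = a *\<^sub>R u + b *\<^sub>R v" by (simp add: algebra_simps)
    have "g1 y = a" "g2 y = b" unfolding y by (simp_all add: l1 l2 g1 g2)
    then show ?thesis using y by simp
  qed
  define Q where "Q = (\<lambda>(a, b, c) y z. a * g1 y * g1 z + b * (g1 y * g2 z + g2 y * g1 z) + c * g2 y * g2 z)"
  have Q: "Q (a, b, c) y z = a * g1 y * g1 z + b * (g1 y * g2 z + g2 y * g1 z) + c * g2 y * g2 z"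
    for a b c y z by (simp add: Q_def)
  \<comment> \<open>Positive definite members are ellipses \<open>Q \<le> 1\<close> containing the
    unit ball, so maximal determinant means minimal area: the Loewner ellipse.\<close>
  define \<K> where "\<K> = {p. \<forall>y. 0 \<le> Q p y y \<and> Q p y y \<le> (norm y)\<^sup>2}"
  define det where "det = (\<lambda>(a, b, c). a * c - b\<^sup>2 :: real)"
  have det: "det (a, b, c) = a * c - b\<^sup>2" for a b c by (simp add: det_def)
  have "compact \<K>"
  proof -
    have "continuous_on UNIV (\<lambda>p. Q p y y)" for y
      unfolding Q_def case_prod_unfold by (intro continuous_intros)
    then have "closed \<K>"
      unfolding \<K>_def by (intro closed_Collect_all closed_Collect_conj closed_Collect_le continuous_intros)
    moreover have "bounded \<K>"
    proof -
      define M where "M = (norm (u + v))\<^sup>2 + (norm u)\<^sup>2 + (norm v)\<^sup>2"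
      have "\<K> \<subseteq> {- M..M} \<times> {- M..M} \<times> {- M..M}"
      proof
        fix p assume p: "p \<in> \<K>"
        obtain a b c where abc: "p = (a, b, c)" by (cases p)
        have K: "0 \<le> Q p y y" "Q p y y \<le> (norm y)\<^sup>2" for y using p by (auto simp: \<K>_def)
        have "0 \<le> a" "a \<le> (norm u)\<^sup>2" using K[of u] by (simp_all add: abc Q g1 g2)
        moreover have "0 \<le> c" "c \<le> (norm v)\<^sup>2" using K[of v] by (simp_all add: abc Q g1 g2)
        moreover have "0 \<le> a + b * 2 + c" "a + b * 2 + c \<le> (norm (u + v))\<^sup>2"
          using K[of "u + v"] by (simp_all add: abc Q g1 g2 l1 l2)
        moreover have "0 \<le> (norm (u + v))\<^sup>2" "0 \<le> (norm u)\<^sup>2" "0 \<le> (norm v)\<^sup>2" by simp_all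
        ultimately show "p \<in> {- M..M} \<times> {- M..M} \<times> {- M..M}"
          unfolding abc mem_Times_iff atLeastAtMost_iff fst_conv snd_conv M_def by linarith
      qed
      then show ?thesis by (rule bounded_subset[rotated]) (intro bounded_Times bounded_closed_interval)
    qed
    ultimately show ?thesis by (simp add: compact_eq_bounded_closed)
  qed
  \<comment> \<open>A multiple of the coordinate form small enough for \<open>\<K>\<close>; it makes
    \<open>\<K>\<close> nonempty and the maximal determinant positive.\<close>
  moreover define \<eta> where "\<eta> = 1 / (K1\<^sup>2 + K2\<^sup>2)"
  have \<eta>: "\<eta> > 0" "\<eta> * (K1\<^sup>2 + K2\<^sup>2) = 1" using g1(5) by (simp_all add: \<eta>_def add_pos_nonneg add_nonneg_eq_0_iff)
  have \<eta>K: "(\<eta>, 0, \<eta>) \<in> \<K>"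
  proof -
    have "\<eta> * (g1 y)\<^sup>2 + \<eta> * (g2 y)\<^sup>2 \<le> (norm y)\<^sup>2" for y
    proof -
      have "(g1 y)\<^sup>2 \<le> (K1 * norm y)\<^sup>2" "(g2 y)\<^sup>2 \<le> (K2 * norm y)\<^sup>2"
        using g1(2)[of y] g2(2)[of y] by (metis abs_ge_zero power2_abs power_mono)+
      then have "\<eta> * ((g1 y)\<^sup>2 + (g2 y)\<^sup>2) \<le> \<eta> * ((K1 * norm y)\<^sup>2 + (K2 * norm y)\<^sup>2)"
        using \<eta>(1) by (intro mult_left_mono add_mono) auto
      also have "\<dots> = \<eta> * (K1\<^sup>2 + K2\<^sup>2) * (norm y)\<^sup>2" by (simp add: power_mult_distrib algebra_simps)
      finally show ?thesis unfolding \<eta>(2) by (simp add: distrib_left)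
    qed
    then show ?thesis using \<eta>(1) by (simp add: \<K>_def Q power2_eq_square mult.assoc)
  qed
  ultimately have "\<exists>p\<in>\<K>. \<forall>p'\<in>\<K>. det p' \<le> det p"
    unfolding det_def case_prod_unfold by (intro continuous_attains_sup) (auto intro!: continuous_intros)
  then obtain p where p: "p \<in> \<K>" "\<And>p'. p' \<in> \<K> \<Longrightarrow> det p' \<le> det p" by blast
  obtain a b c where abc: "p = (a, b, c)" by (cases p)
  define D where "D = a * c - b\<^sup>2"
  have D: "D > 0"
  proof -
    have "0 < \<eta> * \<eta>" using \<eta>(1) by simp
    also have "\<dots> \<le> D" using p(2)[OF \<eta>K] by (simp add: abc det D_def)
    finally show ?thesis .
  qed
  have pK: "0 \<le> Q p y y" "Q p y y \<le> (norm y)\<^sup>2" for y using p(1) by (auto simp: \<K>_def)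
  have a: "a > 0"
  proof -
    have "a \<ge> 0" using pK[of u] by (simp add: abc Q g1 g2)
    moreover have "a \<noteq> 0" using D by (auto simp: D_def)
    ultimately show ?thesis by simp
  qed
  \<comment> \<open>\<open>d T\<close> is the determinant of \<open>T\<close> in the basis
    \<open>u\<close>, \<open>v\<close>, and \<open>pull T\<close> is the form \<open>p\<close>
    pulled back along \<open>T\<close>.\<close>
  define d where "d T = g1 (T u) * g2 (T v) - g2 (T u) * g1 (T v)" for T :: "'a \<Rightarrow> 'a"
  define pull where "pull T = (Q p (T u) (T u), Q p (T u) (T v), Q p (T v) (T v))" for T :: "'a \<Rightarrow> 'a"
  have lin_coord: "g1 (T y) = g1 y * g1 (T u) + g2 y * g1 (T v)" "g2 (T y) = g1 y * g2 (T u) + g2 y * g2 (T v)"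
    if T: "T \<in> isometry_group" for T y
  proof -
    have Ty: "T y = g1 y *\<^sub>R T u + g2 y *\<^sub>R T v"
      using coord[of y] linear_add[OF isometry_groupD(1)[OF T]] linear_scale[OF isometry_groupD(1)[OF T]] by metis
    show "g1 (T y) = g1 y * g1 (T u) + g2 y * g1 (T v)" "g2 (T y) = g1 y * g2 (T u) + g2 y * g2 (T v)"
      unfolding Ty by (simp_all add: l1 l2)
  qed
  have Qpull: "Q (pull T) y z = Q p (T y) (T z)" if T: "T \<in> isometry_group" for T y z
    unfolding pull_def abc Q lin_coord[OF T, of y] lin_coord[OF T, of z] by (simp add: algebra_simps)
  have pullK: "pull T \<in> \<K>" if T: "T \<in> isometry_group" for T
    using pK[of "T _"] by (simp add: \<K>_def Qpull[OF T] isometry_groupD(2)[OF T])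
  have det_pull: "det (pull T) = (d T)\<^sup>2 * D" for T
    unfolding pull_def abc Q det d_def D_def by (simp add: algebra_simps power2_eq_square)
  have d_le: "(d T)\<^sup>2 \<le> 1" if T: "T \<in> isometry_group" for T
    using p(2)[OF pullK[OF T]] D unfolding det_pull abc det D_def[symmetric] by simp
  \<comment> \<open>Maximality bounds the squared determinants of \<open>T\<close> and of its
    inverse by 1, and their product is 1.\<close>
  have d1: "(d T)\<^sup>2 = 1" if T: "T \<in> isometry_group" for T
  proof -
    obtain S where S: "S \<in> isometry_group" "\<And>z. S (T z) = z" using isometry_group_inverse[OF T] by blast
    have eqs: "1 = g1 (T u) * g1 (S u) + g2 (T u) * g1 (S v)" "0 = g1 (T u) * g2 (S u) + g2 (T u) * g2 (S v)"
      "0 = g1 (T v) * g1 (S u) + g2 (T v) * g1 (S v)" "1 = g1 (T v) * g2 (S u) + g2 (T v) * g2 (S v)"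
      using lin_coord[OF S(1), of "T u"] lin_coord[OF S(1), of "T v"] unfolding S(2) g1(3,4) g2(3,4) by blast+
    have "d T * d S = (g1 (T u) * g1 (S u) + g2 (T u) * g1 (S v)) * (g1 (T v) * g2 (S u) + g2 (T v) * g2 (S v))
       - (g1 (T u) * g2 (S u) + g2 (T u) * g2 (S v)) * (g1 (T v) * g1 (S u) + g2 (T v) * g1 (S v))"
      unfolding d_def by (simp add: algebra_simps)
    also have "\<dots> = 1" unfolding eqs[symmetric] by simp
    finally have "(d T)\<^sup>2 * (d S)\<^sup>2 = 1" by (simp flip: power_mult_distrib)
    moreover have "(d T)\<^sup>2 * (d S)\<^sup>2 \<le> (d T)\<^sup>2 * 1" using d_le[OF S(1)] by (intro mult_left_mono) auto
    ultimately show ?thesis using d_le[OF T] by simp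
  qed
  \<comment> \<open>Both forms have the maximal determinant, and their midpoint lies in
    \<open>\<K>\<close>. Strict concavity of the square root of the determinant, made explicit below
    by a sum of squares, forces them to agree.\<close>
  have pull_eq: "pull T = p" if T: "T \<in> isometry_group" for T
  proof -
    obtain a' b' c' where abc': "pull T = (a', b', c')" by (cases "pull T")
    have D': "a' * c' = D + b'\<^sup>2" using det_pull[of T] d1[OF T] by (simp add: abc' det)
    have Dc: "a * c = D + b\<^sup>2" by (simp add: D_def)
    have "a' \<ge> 0" using pK[of "T u"] abc' by (simp add: pull_def)
    moreover have "a' \<noteq> 0"
    proof
      assume "a' = 0"
      then have "D + b'\<^sup>2 = 0" using D' by simp
      then show False using D zero_le_power2[of b'] by linarith
    qed
    ultimately have a': "a' > 0" by simp
    have avg: "Q ((a + a') / 2, (b + b') / 2, (c + c') / 2) y y = (Q p y y + Q (pull T) y y) / 2" for y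
      unfolding abc abc' Q by (simp add: field_simps)
    have "0 \<le> (Q p y y + Q (pull T) y y) / 2 \<and> (Q p y y + Q (pull T) y y) / 2 \<le> (norm y)\<^sup>2" for y
    proof -
      have "0 \<le> Q (pull T) y y" "Q (pull T) y y \<le> (norm y)\<^sup>2"
        using pullK[OF T] by (auto simp: \<K>_def)
      then show ?thesis using pK[of y] by auto
    qed
    then have "((a + a') / 2, (b + b') / 2, (c + c') / 2) \<in> \<K>"
      unfolding \<K>_def mem_Collect_eq avg by blast
    then have "det ((a + a') / 2, (b + b') / 2, (c + c') / 2) \<le> det p" by (rule p(2))
    then have "(a + a') / 2 * ((c + c') / 2) - ((b + b') / 2)\<^sup>2 \<le> D"
      unfolding abc det D_def .
    then have "(a + a') * (c + c') - (b + b')\<^sup>2 \<le> 4 * D" by (simp add: power_divide)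
    then have "a * c' + a' * c - 2 * b * b' \<le> 2 * D" using D' Dc by (simp add: algebra_simps power2_eq_square)
    then have "a * a' * (a * c' + a' * c - 2 * b * b') \<le> a * a' * (2 * D)"
      using a a' by (intro mult_left_mono) auto
    moreover have "a * a' * (a * c' + a' * c - 2 * b * b') = a\<^sup>2 * (a' * c') + a'\<^sup>2 * (a * c) - 2 * (a * b') * (a' * b)"
      by (simp add: algebra_simps power2_eq_square)
    then have "a * a' * (a * c' + a' * c - 2 * b * b') = D * (a - a')\<^sup>2 + (a * b' - a' * b)\<^sup>2 + a * a' * (2 * D)"
      unfolding D' Dc by (simp add: algebra_simps power2_eq_square)
    ultimately have "D * (a - a')\<^sup>2 + (a * b' - a' * b)\<^sup>2 \<le> 0" by linarith
    moreover have "D * (a - a')\<^sup>2 \<ge> 0" using D by simp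
    moreover have "(a * b' - a' * b)\<^sup>2 \<ge> 0" by simp
    ultimately have "D * (a - a')\<^sup>2 = 0" "(a * b' - a' * b)\<^sup>2 = 0" by linarith+
    then have "a' = a" "a * b' = a' * b" using D by simp_all
    then have "b' = b" using a by simp
    then have "c' = c" using D' Dc \<open>a' = a\<close> a by (metis less_irrefl mult_cancel_left)
    then show ?thesis using \<open>a' = a\<close> \<open>b' = b\<close> abc abc' by simp
  qed
  define q where "q y = Q p y y" for y
  have inv: "q (T y) = q y" if "T \<in> isometry_group" for T y
    using Qpull[OF that, of y y] pull_eq[OF that] by (simp add: q_def)
  \<comment> \<open>A sublevel set of the nonnegative form is closed and convex, and by invariance
    it contains the orbit of \<open>w\<close>, hence the unit ball.\<close>
  have q_le: "q y \<le> q w" if yw: "norm y = 1" "norm w = 1" for y w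
  proof -
    have "convex {z. q z \<le> q w}"
    proof (rule convexI)
      fix x y :: 'a and s t :: real
      assume xy: "x \<in> {z. q z \<le> q w}" "y \<in> {z. q z \<le> q w}" and st: "0 \<le> s" "0 \<le> t" "s + t = 1"
      have t: "t = 1 - s" using st by simp
      have "q (s *\<^sub>R x + t *\<^sub>R y) = s * q x + t * q y - s * t * q (x - y)"
        unfolding q_def abc Q l1 l2 t by (simp add: algebra_simps)
      moreover have "s * t * q (x - y) \<ge> 0" using st pK(1) by (simp add: q_def)
      moreover have "s * q x + t * q y \<le> s * q w + t * q w"
        using xy st by (intro add_mono mult_left_mono) auto
      moreover have "s * q w + t * q w = q w" using st by (metis distrib_right mult_1)
      ultimately show "s *\<^sub>R x + t *\<^sub>R y \<in> {z. q z \<le> q w}" by simp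
    qed
    moreover have "continuous_on UNIV g1" "continuous_on UNIV g2"
      using bounded_linear_of_bound[OF g1(1,2)] bounded_linear_of_bound[OF g2(1,2)]
      by (auto intro: linear_continuous_on)
    then have "closed {z. q z \<le> q w}"
      unfolding q_def abc Q by (intro closed_Collect_le continuous_intros)
    ultimately have "closure (convex hull {T w | T. T \<in> (isometry_group :: ('a \<Rightarrow> 'a) set)}) \<subseteq> {z. q z \<le> q w}"
      by (intro closure_minimal hull_minimal) (auto simp: inv)
    moreover have "y \<in> closure (convex hull {T w | T. T \<in> (isometry_group :: ('a \<Rightarrow> 'a) set)})"
      using ct yw unfolding convex_transitive_def by auto
    ultimately show ?thesis by auto
  qed
  have u0: "u \<noteq> 0" using uv span_zero by auto
  define w where "w = (1 / norm u) *\<^sub>R u"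
  have w: "norm w = 1" using u0 by (simp add: w_def)
  have "q w = a / (norm u)\<^sup>2"
    unfolding q_def abc Q w_def l1 l2 by (simp add: g1 g2 power2_eq_square)
  then have qw: "q w > 0" using a u0 by simp
  have "Q p x x = q w * (norm x)\<^sup>2" for x
  proof (cases "x = 0")
    case True
    then show ?thesis by (simp add: abc Q linear_0[OF g1(1)] linear_0[OF g2(1)])
  next
    case False
    define y where "y = (1 / norm x) *\<^sub>R x"
    have y: "norm y = 1" "x = norm x *\<^sub>R y" using False by (auto simp: y_def)
    have "q y = q w" using q_le[OF y(1) w] q_le[OF w y(1)] by simp
    moreover have "q (norm x *\<^sub>R y) = (norm x)\<^sup>2 * q y"
      unfolding q_def abc Q l1 l2 by (simp add: power2_eq_square algebra_simps)
    ultimately show ?thesis using y(2) by (simp add: q_def)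
  qed
  then show ?thesis
    by (intro norm_from_inner_product_scaled[of "Q p" "q w"] qw)
      (auto intro!: linearI simp: abc Q l1 l2 algebra_simps)
qed

lemma at_most_two_dimensional:
  assumes ct: "convex_transitive TYPE('a)" and plane: "\<And>y. y \<in> span {u, v :: 'a}"
  shows "norm_from_inner_product TYPE('a)"
proof -
  consider "u \<in> span {v}" | "v \<in> span {u}" | "u \<notin> span {v}" "v \<notin> span {u}" by blast
  then show ?thesis
  proof cases
    case 1
    then show ?thesis using plane by (intro one_dimensional[of v]) (simp add: span_redundant)
  next
    case 2
    then show ?thesis
      using plane by (intro one_dimensional[of u]) (simp add: span_redundant insert_commute[of u v])
  qed (use two_dimensional ct plane in blast)
qed

end

text \<open>A functional supporting the unit vector \<open>e\<close> of the range reads off the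
  coefficient of \<open>P z\<close>; being a contraction, like \<open>P\<close>, it keeps
  \<open>f z \<le> norm z\<close>.\<close>

lemma one_dimensional_projection:
  fixes P :: "'a::real_normed_vector \<Rightarrow> 'a"
  assumes dim: "dim (range P) = 1" and P: "bicontractive_projection P" and sub: "subspace (range P)"
  obtains f e where "linear f" "\<And>z. f z \<le> norm z" "f e = 1" "norm e = 1" "\<And>z. P z = f z *\<^sub>R e"
proof -
  have lin: "linear P" and idem: "\<And>z. P (P z) = P z" and contr: "\<And>z. norm (P z) \<le> norm z"
    using P by (auto simp: bicontractive_projection_def)
  obtain \<B> where \<B>: "\<B> \<subseteq> range P" "independent \<B>" "range P \<subseteq> span \<B>" "card \<B> = 1"
    using basis_exists[of "range P"] dim by metis
  then obtain b where b: "\<B> = {b}" by (auto simp: card_1_singleton_iff)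
  have b0: "b \<noteq> 0" using \<B>(2) b by auto
  define e where "e = (1 / norm b) *\<^sub>R b"
  have e: "norm e = 1" using b0 by (simp add: e_def)
  have "e \<in> range P" unfolding e_def using \<B>(1) b sub by (intro subspace_scale) auto
  then have Pe: "P e = e" using idem by auto
  obtain k where k: "supports k e" using supports_ex by blast
  have Pz: "P z = k (P z) *\<^sub>R e" for z
  proof -
    have "P z \<in> span {b}" using \<B>(3) b by auto
    then obtain c where "P z = c *\<^sub>R b" by (auto simp: span_singleton)
    then have c: "P z = (c * norm b) *\<^sub>R e" using b0 by (simp add: e_def)
    then show ?thesis using supportsD(4)[OF k] e by (simp add: linear_scale[OF supportsD(1)[OF k]])
  qed
  show ?thesis
  proof (rule that[of "\<lambda>z. k (P z)" e])
    show "linear (\<lambda>z. k (P z))" using linear_compose[OF lin supportsD(1)[OF k]] by (simp add: comp_def)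
    show "k (P z) \<le> norm z" for z using supportsD(2)[OF k, of "P z"] contr[of z] by simp
    show "k (P e) = 1" using supportsD(4)[OF k] e Pe by simp
  qed (rule e, rule Pz)
qed

theorem theorem5p3:
  fixes P :: "'a::banach \<Rightarrow> 'a" and L :: "'a set" and x :: 'a
  assumes "convex_transitive TYPE('a)"
    and "subspace L" and "dim L = 1"
    and "bicontractive_projection P" and "range P = L"
    and "omega_LUR_point x"
  shows "norm_from_inner_product TYPE('a)"
proof -
  obtain f e where fe: "linear f" "\<And>z. f z \<le> norm z" "f e = 1" "norm e = 1" "\<And>z. P z = f z *\<^sub>R e"
    using one_dimensional_projection[of P] assms by metis
  have bi: "norm (w - f w *\<^sub>R e) \<le> norm w" for w
    using assms(4) unfolding bicontractive_projection_def fe(5)[of w, symmetric] by blast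
  interpret lur: bicontractive_lur f e x
    by (rule bicontractive_lur.intro[OF assms(1) fe(1-4) bi assms(6)])
  interpret symmetric_orth "TYPE('a)"
    by unfold_locales (rule lur.orth_sym)
  show ?thesis
  proof (cases "\<exists>a b. \<forall>y::'a. y \<in> span {a, b}")
    case True
    then show ?thesis using at_most_two_dimensional[OF assms(1)] by blast
  next
    case False
    \<comment> \<open>The base point of the chart may be any unit vector; \<open>e\<close> is at
      hand.\<close>
    then interpret symmetric_orth_chart "TYPE('a)" e
      by unfold_locales (use fe in auto)
    show ?thesis by (rule norm_from_inner_product)
  qed
qed

end
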